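(* We have $\widehat{\sigma}_2 \ge 17$.
   Context: For $\mathbf{c}\in\mathbb{R}^2$, the unit disk with center $\mathbf{c}$ is the open disk $D_{\mathbf{c}}=\{\mathbf{x}\in\mathbb{R}^2 : \|\mathbf{x}-\mathbf{c}\|<1\}$ (Euclidean norm). For a finite point set $X\subset\mathbb{R}^2$, a family $\mathscr{D}$ of (not necessarily disjoint) unit disks is an exact cover of $X$ if each point $\mathbf{x}\in X$ is contained in exactly one disk $D\in\mathscr{D}$. Let $\widehat{\sigma}_2$ be the largest $n\in\mathbb{N}$ such that every set of $n$ points in the plane $\mathbb{R}^2$ has an exact cover by unit disks. *)

theory Defs
  imports "HOL-Analysis.Analysis"
begin

definition unit_disk :: "real^2 \<Rightarrow> (real^2) set" where
  "unit_disk c = {x. norm (x - c) < 1}"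

definition exact_cover :: "(real^2) set set \<Rightarrow> (real^2) set \<Rightarrow> bool" where
  "exact_cover \<D> X \<longleftrightarrow> \<D> \<subseteq> range unit_disk \<and> (\<forall>x\<in>X. \<exists>!D. D \<in> \<D> \<and> x \<in> D)"

definition all_exactly_coverable :: "nat \<Rightarrow> bool" where
  "all_exactly_coverable n \<longleftrightarrow>
     (\<forall>X :: (real^2) set. finite X \<and> card X = n \<longrightarrow> (\<exists>\<D>. exact_cover \<D> X))"

(* GREATEST is meaningful here: n = 0 qualifies, and the admissible n are bounded, since
   a sufficiently fine finite grid in a large enough square has no exact cover by unit disks
   and admissibility of n passes to every smaller number. *)
definition sigma_hat_2 :: nat where
  "sigma_hat_2 = (GREATEST n. all_exactly_coverable n)"

end

theory Submission
  imports Defs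
begin

text \<open>
  Two things have to be shown: every set of 17 points has an exact cover, and the numbers n for which
  all n-point sets have one are bounded, since otherwise the greatest such number would carry no
  information.

  For the bound, a disk of an exact cover of a sufficiently fine net must be surrounded by other disks
  of the cover that hardly overlap it but reach every point just outside it. Hence there is a disk
  almost touching it in every direction, and for two directions at a small angle
  these two disks are distinct and overlap by much (\<open>exists_finite_set_without_exact_cover\<close>).

  For 17 points, call a point of X private if some unit disk contains it and no other point of
  X. A family of unit disks that covers no point twice, and covers all points that are
  not private, extends to an exact cover (\<open>exact_cover_by_private_points\<close>). The set X either
  lies in a closed unit disk, in which case the open disk covers all points except private ones on its
  boundary, or it has at least four private points (\<open>four_private_points\<close>); fix four of
  them and call them special.
  In the second case, place unit disks at a random translate of a hexagonal lattice of area A per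
  point, with spacing slightly below 2, so that neighbouring disks overlap in thin lenses. Each
  of the 13 other points is bad if it is covered zero times or twice, while a special point is bad only
  if it is covered twice. With K the area of three lenses (that is, of their six halves), the expected
  number of bad points is at most (13 (A - pi + 2 K) + 4 K) / A, which slightly exceeds 1. It falls below 1
  through the following saving. In each of the six lattice directions e let m(e) be the
  non-special point that is least in direction e. If m(e) lies in the half towards D + e of the lens
  of D and D + e, then all non-special points of D lie in D + e as well, so that D can be
  dropped. This reduces the expectation by K / A, and
  13 (A - pi + 2 K) + 3 K < A for spacing 1214/625 (\<open>good_translation\<close>).
\<close>

section \<open>A finite set without an exact cover\<close>

lemma unit_disk_eq_iff: "unit_disk a = unit_disk b \<longleftrightarrow> a = b"
proof -
  have "unit_disk c = ball c 1" for c :: "real^2"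
    by (auto simp: unit_disk_def dist_norm norm_minus_commute)
  then show ?thesis
    by (simp add: ball_eq_ball_iff)
qed

lemma exact_cover_unique:
  assumes "exact_cover \<D> X" "x \<in> X" "unit_disk a \<in> \<D>" "unit_disk b \<in> \<D>"
    "norm (x - a) < 1" "norm (x - b) < 1"
  shows "a = b"
  using assms unfolding exact_cover_def
  by (metis (mono_tags, lifting) mem_Collect_eq unit_disk_def unit_disk_eq_iff)

lemma exact_cover_disk:
  assumes "exact_cover \<D> X" "x \<in> X"
  obtains b where "unit_disk b \<in> \<D>" "norm (x - b) < 1"
proof -
  obtain D where D: "D \<in> \<D>" "x \<in> D"
    using assms unfolding exact_cover_def by blast
  then obtain b where "D = unit_disk b"
    using assms(1) unfolding exact_cover_def by blast
  then show ?thesis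
    using that[of b] D by (simp add: unit_disk_def)
qed

text \<open>If two disks overlap in a disk of radius at least \<open>\<epsilon>\<close>, then the overlap contains a point
  of the net, and this point would be covered twice.\<close>
lemma overlapping_unit_disks_equal:
  fixes X :: "(real^2) set"
  assumes X: "exact_cover \<D> X" and ab: "unit_disk a \<in> \<D>" "unit_disk b \<in> \<D>"
    and net: "\<And>y. norm y \<le> 10 \<Longrightarrow> \<exists>x\<in>X. norm (x - y) < \<epsilon>"
    and small: "norm a \<le> 10" "norm b \<le> 10" and close: "norm (a - b) \<le> 2 - 2 * \<epsilon>"
  shows "a = b"
proof -
  define m where "m = (1/2) *\<^sub>R (a + b)"
  have "norm m \<le> 10"
    using small norm_triangle_ineq[of a b] by (simp add: m_def)
  then obtain x where x: "x \<in> X" "norm (x - m) < \<epsilon>"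
    using net by blast
  have "m - a = (1/2) *\<^sub>R (b - a)" "m - b = (1/2) *\<^sub>R (a - b)"
    by (simp_all add: m_def vec_eq_iff field_simps)
  then have "norm (m - a) \<le> 1 - \<epsilon>" "norm (m - b) \<le> 1 - \<epsilon>"
    using close by (simp_all add: norm_minus_commute)
  then have "norm (x - a) < 1" "norm (x - b) < 1"
    using x(2) norm_triangle_ineq[of "x - m" "m - a"] norm_triangle_ineq[of "x - m" "m - b"] by auto
  then show ?thesis
    using exact_cover_unique X ab x(1) by blast
qed

text \<open>A point of the net just outside the disk around c in direction v is covered by another
  disk, around b say. Thus b is at distance little more than 1 from c + v, and at
  distance almost 2 from c because the two disks barely overlap; only points b close to c + 2 v
  satisfy both.\<close>
lemma fine_cover_neighbour:
  fixes X :: "(real^2) set" and v :: "real^2"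
  assumes X: "exact_cover \<D> X" and c: "unit_disk c \<in> \<D>" "norm c \<le> 2"
    and net: "\<And>y. norm y \<le> 10 \<Longrightarrow> \<exists>x\<in>X. norm (x - y) < 1/1000"
    and v: "norm v = 1"
  obtains b where "unit_disk b \<in> \<D>" "norm (b - (c + 2 *\<^sub>R v)) < 3/20" "norm b \<le> 10"
proof -
  \<comment> \<open>The excess 2/1000 over the radius keeps the net point x, which is within 1/1000 of y,
    outside the disk around c.\<close>
  define y where "y = c + (1 + 2/1000) *\<^sub>R v"
  have ncv: "norm (y - c) = 1 + 2/1000"
    using v by (simp add: y_def)
  then have "norm y \<le> 10"
    using c(2) norm_triangle_ineq[of "y - c" c] by simp
  then obtain x where x: "x \<in> X" "norm (x - y) < 1/1000"
    using net by blast
  obtain b where b: "unit_disk b \<in> \<D>" "norm (x - b) < 1"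
    using exact_cover_disk[OF X x(1)] .
  have xc: "norm (x - c) > 1"
    using ncv x(2) norm_triangle_ineq[of "x - c" "y - x"] by (simp add: norm_minus_commute)
  have "b \<noteq> c"
    using xc b(2) by auto
  have "norm (x - c) < 2"
    using ncv x(2) norm_triangle_ineq[of "x - y" "y - c"] by simp
  then have nb: "norm b \<le> 10"
    using b(2) c(2) norm_triangle_ineq[of "b - x" "x - c"] norm_triangle_ineq[of "b - c" c]
    by (simp add: norm_minus_commute)
  have "norm (b - c) > 2 - 2 * (1/1000)"
    using overlapping_unit_disks_equal[OF X b(1) c(1) net nb] \<open>b \<noteq> c\<close> c(2) by fastforce
  then have far: "(b - c) \<bullet> (b - c) > (2 - 2/1000)\<^sup>2"
    unfolding dot_square_norm by (intro power_strict_mono) auto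
  define u where "u = b - c"
  have uv: "u - v = (b - x) + (x - y) + (2/1000) *\<^sub>R v"
    by (simp add: u_def y_def vec_eq_iff field_simps)
  have "norm (u - v) \<le> norm (b - x) + norm (x - y) + norm ((2/1000) *\<^sub>R v)"
    unfolding uv using norm_triangle_ineq[of "b - x + (x - y)" "(2/1000) *\<^sub>R v"]
      norm_triangle_ineq[of "b - x" "x - y"] by linarith
  then have "norm (u - v) \<le> 1 + 3/1000"
    using b(2) x(2) v by (simp add: norm_minus_commute)
  then have near: "(u - v) \<bullet> (u - v) \<le> (1 + 3/1000)\<^sup>2"
    unfolding dot_square_norm by (intro power_mono) auto
  have vv: "v \<bullet> v = 1"
    using v by (simp add: dot_square_norm)
  \<comment> \<open>The parallelogram law for u - v and v, whose sum is u.\<close>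
  have "(u - 2 *\<^sub>R v) \<bullet> (u - 2 *\<^sub>R v) = 2 * ((u - v) \<bullet> (u - v)) - u \<bullet> u + 2 * (v \<bullet> v)"
    by (simp add: inner_diff_left inner_diff_right inner_commute algebra_simps)
  also have "\<dots> < (3/20)\<^sup>2"
    using near far vv by (simp add: u_def power2_eq_square)
  finally have "(norm (u - 2 *\<^sub>R v))\<^sup>2 < (3/20)\<^sup>2"
    by (simp only: dot_square_norm)
  then have "norm (u - 2 *\<^sub>R v) < 3/20"
    by (rule power2_less_imp_less) simp
  then show ?thesis
    using that b(1) nb by (simp add: u_def algebra_simps)
qed

text \<open>The centres of the disks that touch a given unit disk in the directions v and w are
  at distance 2 |v - w|. For the two unit vectors chosen here this is about 1.26, far from both 0 and
  2, and the errors of 3/20 from \<open>fine_cover_neighbour\<close> do not change that.\<close>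
lemma exists_finite_set_without_exact_cover:
  obtains X :: "(real^2) set" where "finite X" "\<nexists>\<D>. exact_cover \<D> X"
proof -
  have "\<forall>e>0. \<exists>k. finite k \<and> cball (0::real^2) 10 \<subseteq> (\<Union>x\<in>k. ball x e)"
    using compact_cball[of "0::real^2" 10] unfolding compact_eq_totally_bounded by blast
  from this[rule_format, of "1/1000"]
  obtain X :: "(real^2) set" where X: "finite X" "cball 0 10 \<subseteq> (\<Union>x\<in>X. ball x (1/1000))"
    by auto
  have net: "\<exists>x\<in>X. norm (x - y) < 1/1000" if "norm y \<le> 10" for y
    using X(2) that by (auto simp: subset_iff dist_norm)
  have False if \<D>: "exact_cover \<D> X" for \<D>
  proof -
    obtain x where x: "x \<in> X" "norm x < 1/1000"
      using net[of 0] by auto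
    obtain c where c: "unit_disk c \<in> \<D>" "norm (x - c) < 1"
      using exact_cover_disk[OF \<D> x(1)] .
    have c2: "norm c \<le> 2"
      using x(2) c(2) norm_triangle_ineq[of "c - x" x] by (simp add: norm_minus_commute)
    define v w where "v = (vector [1, 0] :: real^2)" and "w = (vector [4/5, 3/5] :: real^2)"
    have vw: "norm v = 1" "norm w = 1"
      by (simp_all add: v_def w_def norm_vec_def L2_set_def sum_2 vector_2 power2_eq_square)
    obtain a where a: "unit_disk a \<in> \<D>" "norm (a - (c + 2 *\<^sub>R v)) < 3/20" "norm a \<le> 10"
      using fine_cover_neighbour[OF \<D> c(1) c2 net vw(1)] .
    obtain b where b: "unit_disk b \<in> \<D>" "norm (b - (c + 2 *\<^sub>R w)) < 3/20" "norm b \<le> 10"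
      using fine_cover_neighbour[OF \<D> c(1) c2 net vw(2)] .
    define g where "g = 2 *\<^sub>R v - 2 *\<^sub>R w"
    have "norm g = sqrt (8/5)"
      by (simp add: g_def v_def w_def norm_vec_def L2_set_def sum_2 vector_2 power2_eq_square)
    moreover have "sqrt (8/5) < 13/10"
      by (rule real_less_lsqrt) (simp_all add: power2_eq_square)
    moreover have "sqrt (8/5) > 12/10"
      by (rule real_less_rsqrt) (simp add: power2_eq_square)
    ultimately have g: "12/10 < norm g" "norm g < 13/10"
      by simp_all
    define p q where "p = a - (c + 2 *\<^sub>R v)" and "q = b - (c + 2 *\<^sub>R w)"
    have pq: "norm p < 3/20" "norm q < 3/20"
      using a(2) b(2) by (simp_all add: p_def q_def)
    have "a - b = g + (p - q)"
      by (simp add: g_def p_def q_def algebra_simps)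
    then have "norm g - norm (p - q) \<le> norm (a - b)" "norm (a - b) \<le> norm g + norm (p - q)"
      using norm_triangle_ineq[of g "p - q"] norm_diff_ineq[of g "p - q"] by simp_all
    moreover have "norm (p - q) \<le> norm p + norm q"
      by (rule norm_triangle_ineq4)
    ultimately have ab: "norm (a - b) \<le> 2 - 2 * (1/1000)" "norm (a - b) > 0"
      using g pq by linarith+
    then show False
      using overlapping_unit_disks_equal[OF \<D> a(1) b(1) net a(3) b(3) ab(1)] by auto
  qed
  then show ?thesis
    using that X(1) by blast
qed

lemma exact_cover_subset: "exact_cover \<D> X \<Longrightarrow> Y \<subseteq> X \<Longrightarrow> exact_cover \<D> Y"
  unfolding exact_cover_def by blast

lemma exactly_coverable_bounded: "\<exists>b. \<forall>n. all_exactly_coverable n \<longrightarrow> n \<le> b"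
proof -
  obtain X :: "(real^2) set" where X: "finite X" "\<nexists>\<D>. exact_cover \<D> X"
    using exists_finite_set_without_exact_cover .
  have "n \<le> card X" if n: "all_exactly_coverable n" for n
  proof (rule ccontr)
    assume "\<not> n \<le> card X"
    have "infinite (UNIV :: (real^2) set)"
      by (rule infinite_UNIV_char_0)
    then obtain Z where Z: "finite Z" "card Z = n - card X" "Z \<subseteq> UNIV - X"
      using X(1) infinite_arbitrarily_large[of "UNIV - X" "n - card X"] by auto
    define Y where "Y = X \<union> Z"
    have "X \<inter> Z = {}"
      using Z by blast
    then have "finite Y" "card Y = n" "X \<subseteq> Y"
      using X(1) Z \<open>\<not> n \<le> card X\<close> by (auto simp: Y_def card_Un_disjoint)
    then show False
      using n X(2) exact_cover_subset unfolding all_exactly_coverable_def by blast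
  qed
  then show ?thesis by blast
qed

section \<open>Private points\<close>
definition private_point :: "(real^2) set \<Rightarrow> real^2 \<Rightarrow> bool" where
  "private_point X x \<longleftrightarrow> (\<exists>c. X \<inter> unit_disk c = {x})"

text \<open>Points that are still uncovered receive a disk of their own, which disturbs no other point.\<close>
lemma exact_cover_by_private_points:
  assumes disks: "\<C> \<subseteq> range unit_disk"
    and once: "\<And>x D D'. x \<in> X \<Longrightarrow> D \<in> \<C> \<Longrightarrow> D' \<in> \<C> \<Longrightarrow> x \<in> D \<Longrightarrow> x \<in> D' \<Longrightarrow> D = D'"
    and priv: "\<And>x. x \<in> X - \<Union>\<C> \<Longrightarrow> private_point X x"
  shows "\<exists>\<D>. exact_cover \<D> X"
proof -
  obtain c where c: "\<And>x. x \<in> X - \<Union>\<C> \<Longrightarrow> X \<inter> unit_disk (c x) = {x}"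
    using priv unfolding private_point_def by metis
  define \<D> where "\<D> = \<C> \<union> (unit_disk \<circ> c) ` (X - \<Union>\<C>)"
  have "\<exists>!D. D \<in> \<D> \<and> x \<in> D" if x: "x \<in> X" for x
  proof (cases "x \<in> \<Union>\<C>")
    case True
    then obtain D where D: "D \<in> \<C>" "x \<in> D"
      by blast
    show ?thesis
    proof (rule ex1I[of _ D])
      show "D \<in> \<D> \<and> x \<in> D"
        using D by (simp add: \<D>_def)
      show "E = D" if E: "E \<in> \<D> \<and> x \<in> E" for E
      proof (cases "E \<in> \<C>")
        case True
        then show ?thesis
          using E D x once by blast
      next
        case False
        then obtain y where "y \<in> X - \<Union>\<C>" "E = unit_disk (c y)"
          using E unfolding \<D>_def by auto
        then have "x = y"
          using c E x by blast
        then show ?thesis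
          using \<open>x \<in> \<Union>\<C>\<close> \<open>y \<in> X - \<Union>\<C>\<close> by blast
      qed
    qed
  next
    case False
    then have "X \<inter> unit_disk (c x) = {x}"
      using c x by blast
    show ?thesis
    proof (rule ex1I[of _ "unit_disk (c x)"])
      show "unit_disk (c x) \<in> \<D> \<and> x \<in> unit_disk (c x)"
        using c[of x] x False unfolding \<D>_def by auto
      show "E = unit_disk (c x)" if E: "E \<in> \<D> \<and> x \<in> E" for E
      proof -
        have "E \<notin> \<C>"
          using E False by blast
        then obtain y where y: "y \<in> X - \<Union>\<C>" "E = unit_disk (c y)"
          using E unfolding \<D>_def by auto
        then have "x = y"
          using c[OF y(1)] E x by blast
        then show ?thesis
          using y by simp
      qed
    qed
  qed
  moreover have "\<D> \<subseteq> range unit_disk"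
    using disks by (auto simp: \<D>_def)
  ultimately have "exact_cover \<D> X"
    unfolding exact_cover_def by simp
  then show ?thesis ..
qed

text \<open>Push the disk slightly towards x: the other points are at a positive distance from the closed
  disk and stay outside.\<close>
lemma private_if_touching:
  assumes "finite X" "x \<in> X" and x: "norm (x - c) = 1"
    and others: "\<And>y. y \<in> X \<Longrightarrow> y \<noteq> x \<Longrightarrow> norm (y - c) > 1"
  shows "private_point X x"
proof -
  define \<delta> where "\<delta> = Min (insert 1 ((\<lambda>y. norm (y - c) - 1) ` (X - {x})))"
  have fin: "finite (insert 1 ((\<lambda>y. norm (y - c) - 1) ` (X - {x})))"
    using assms(1) by simp
  have \<delta>: "\<delta> > 0" "\<delta> \<le> 1" "\<And>y. y \<in> X \<Longrightarrow> y \<noteq> x \<Longrightarrow> \<delta> \<le> norm (y - c) - 1"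
    unfolding \<delta>_def using fin others by (auto simp: Min_gr_iff)
  define c' where "c' = c + \<delta> *\<^sub>R (x - c)"
  have "x - c' = (1 - \<delta>) *\<^sub>R (x - c)"
    by (simp add: c'_def algebra_simps)
  then have "norm (x - c') < 1"
    using \<delta>(1,2) x by simp
  moreover have "norm (y - c') \<ge> 1" if "y \<in> X" "y \<noteq> x" for y
  proof -
    have "y - c = (y - c') + \<delta> *\<^sub>R (x - c)"
      by (simp add: c'_def)
    then have "norm (y - c) \<le> norm (y - c') + norm (\<delta> *\<^sub>R (x - c))"
      by (metis norm_triangle_ineq)
    then have "norm (y - c) \<le> norm (y - c') + \<delta>"
      using x \<delta>(1) by simp
    then show ?thesis
      using \<delta>(3)[OF that] by simp
  qed
  ultimately have "X \<inter> unit_disk c' = {x}"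
    using assms(2) by (force simp: unit_disk_def)
  then show ?thesis
    unfolding private_point_def by blast
qed

text \<open>The unit disk that touches the supporting line at x from the other side meets the half-plane
  in x only.\<close>
lemma private_if_maximal:
  assumes X: "finite X" "x \<in> X" and n: "n \<noteq> 0" and max: "\<And>y. y \<in> X \<Longrightarrow> n \<bullet> y \<le> n \<bullet> x"
  shows "private_point X x"
proof -
  define u where "u = n /\<^sub>R norm n"
  have u: "norm u = 1" "u \<bullet> u = 1"
    using n by (simp_all add: u_def dot_square_norm)
  show ?thesis
  proof (rule private_if_touching[OF X, of "x + u"])
    show "norm (x - (x + u)) = 1"
      using u by simp
    fix y assume y: "y \<in> X" "y \<noteq> x"
    have "u \<bullet> (y - x) \<le> 0"
      using max[OF y(1)] n by (simp add: u_def inner_diff_right mult_le_0_iff)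
    moreover have "(y - x) \<bullet> (y - x) > 0"
      using y by simp
    moreover have "(y - (x + u)) \<bullet> (y - (x + u)) = (y - x) \<bullet> (y - x) - 2 * (u \<bullet> (y - x)) + u \<bullet> u"
      by (simp add: inner_diff_left inner_diff_right inner_add_left inner_add_right inner_commute algebra_simps)
    ultimately have "1 < (y - (x + u)) \<bullet> (y - (x + u))"
      using u(2) by linarith
    then have "1\<^sup>2 < (norm (y - (x + u)))\<^sup>2"
      by (simp add: dot_square_norm)
    then show "norm (y - (x + u)) > 1"
      by (rule power2_less_imp_less) simp
  qed
qed

lemma private_if_on_enclosing_circle:
  assumes X: "finite X" "x \<in> X" and sub: "X \<subseteq> cball z r" and x: "norm (x - z) = r" and r: "r > 0"
  shows "private_point X x"
proof (rule private_if_maximal[OF X, of "x - z"])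
  show "x - z \<noteq> 0"
    using x r by auto
  fix y assume "y \<in> X"
  then have "norm (y - z) \<le> r"
    using sub by (auto simp: dist_norm norm_minus_commute)
  have "(x - z) \<bullet> (y - z) \<le> norm (x - z) * norm (y - z)"
    by (rule norm_cauchy_schwarz)
  also have "\<dots> \<le> norm (x - z) * norm (x - z)"
    using x r \<open>norm (y - z) \<le> r\<close> by simp
  also have "\<dots> = (x - z) \<bullet> (x - z)"
    by (simp add: dot_square_norm power2_eq_square)
  finally show "(x - z) \<bullet> y \<le> (x - z) \<bullet> x"
    by (simp add: inner_diff_right)
qed

lemma exact_cover_if_in_cball:
  assumes X: "finite X" "X \<subseteq> cball z 1"
  shows "\<exists>\<D>. exact_cover \<D> X"
proof (rule exact_cover_by_private_points[of "{unit_disk z}"])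
  fix x assume x: "x \<in> X - \<Union>{unit_disk z}"
  then have "norm (x - z) = 1"
    using X(2) by (auto simp: unit_disk_def dist_norm norm_minus_commute)
  then show "private_point X x"
    using private_if_on_enclosing_circle[OF X(1) _ X(2)] x by simp
qed auto

text \<open>An empty disk of radius larger than 1 contains a unit disk that touches its boundary from the
  inside at x, and at no other point.\<close>
lemma private_if_on_empty_circle:
  assumes X: "finite X" "x \<in> X" and x: "norm (x - k) = \<rho>" and \<rho>: "\<rho> > 1"
    and empty: "\<And>y. y \<in> X \<Longrightarrow> norm (y - k) \<ge> \<rho>"
  shows "private_point X x"
proof -
  define v where "v = (1/\<rho>) *\<^sub>R (k - x)"
  have v: "norm v = 1" "k - x = \<rho> *\<^sub>R v"
    using x \<rho> by (simp_all add: v_def norm_minus_commute)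
  then have vv: "v \<bullet> v = 1"
    by (simp add: dot_square_norm)
  show ?thesis
  proof (rule private_if_touching[OF X, of "x + v"])
    show "norm (x - (x + v)) = 1"
      using v by simp
    fix y assume y: "y \<in> X" "y \<noteq> x"
    define d where "d = y - x"
    have dd: "d \<bullet> d > 0"
      using y by (simp add: d_def)
    have "\<rho>\<^sup>2 \<le> (norm (y - k))\<^sup>2"
      using empty[OF y(1)] \<rho> by simp
    also have "y - k = d - \<rho> *\<^sub>R v"
      using v(2) by (simp add: d_def algebra_simps)
    also have "(norm (d - \<rho> *\<^sub>R v))\<^sup>2 = d \<bullet> d - 2 * \<rho> * (v \<bullet> d) + \<rho>\<^sup>2 * (v \<bullet> v)"
      unfolding power2_norm_eq_inner
      by (simp add: inner_diff_left inner_diff_right inner_commute algebra_simps power2_eq_square)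
    finally have "\<rho> * (2 * (v \<bullet> d)) \<le> d \<bullet> d"
      using vv by simp
    also have "\<dots> < \<rho> * (d \<bullet> d)"
      using \<rho> dd by simp
    finally have "2 * (v \<bullet> d) < d \<bullet> d"
      using \<rho> by simp
    moreover have "(norm (y - (x + v)))\<^sup>2 = (norm (d - v))\<^sup>2"
      by (simp add: d_def algebra_simps)
    moreover have "(norm (d - v))\<^sup>2 = d \<bullet> d - 2 * (v \<bullet> d) + 1"
      using vv by (simp add: power2_norm_eq_inner inner_diff_left inner_diff_right inner_commute
          algebra_simps)
    ultimately have "1\<^sup>2 < (norm (y - (x + v)))\<^sup>2"
      by simp
    then show "norm (y - (x + v)) > 1"
      by (rule power2_less_imp_less) simp
  qed
qed

text \<open>The vertices of the convex hull are private, because a line separates each of them from the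
  remaining points.\<close>
lemma subset_hull_of_private_points:
  assumes X: "finite X"
  shows "X \<subseteq> convex hull {x \<in> X. private_point X x}"
proof -
  have "private_point X x" if x: "x extreme_point_of (convex hull X)" for x
  proof (cases "X = {x}")
    case True
    then have "X \<inter> unit_disk x = {x}"
      by (simp add: unit_disk_def)
    then show ?thesis
      unfolding private_point_def by blast
  next
    case False
    have xX: "x \<in> X"
      using x extreme_point_of_convex_hull by blast
    have "convex (convex hull X - {x})"
      using x extreme_point_of_stillconvex by blast
    moreover have "X - {x} \<subseteq> convex hull X - {x}"
      by (simp add: hull_subset Diff_mono)
    ultimately have "convex hull (X - {x}) \<subseteq> convex hull X - {x}"
      by (simp add: hull_minimal)
    then have "x \<notin> convex hull (X - {x})"
      by blast
    moreover have "closed (convex hull (X - {x}))"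
      using X by (simp add: compact_imp_closed finite_imp_compact_convex_hull)
    ultimately have "\<exists>a b. a \<bullet> x < b \<and> (\<forall>y\<in>convex hull (X - {x}). a \<bullet> y > b)"
      by (intro separating_hyperplane_closed_point convex_convex_hull)
    then obtain a b where ab: "a \<bullet> x < b" "\<And>y. y \<in> convex hull (X - {x}) \<Longrightarrow> a \<bullet> y > b"
      by blast
    obtain y where "y \<in> X - {x}"
      using xX False by blast
    have "a \<noteq> 0"
      using ab(1) ab(2)[OF hull_inc[OF \<open>y \<in> X - {x}\<close>]] by auto
    show ?thesis
    proof (rule private_if_maximal[OF X xX, of "- a"])
      show "- a \<noteq> 0"
        using \<open>a \<noteq> 0\<close> by simp
      show "- a \<bullet> y \<le> - a \<bullet> x" if "y \<in> X" for y
        using ab(1) ab(2)[OF hull_inc, of y] that by (cases "y = x") auto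
    qed
  qed
  then have "{x. x extreme_point_of (convex hull X)} \<subseteq> {x \<in> X. private_point X x}"
    using extreme_point_of_convex_hull by blast
  then have "convex hull {x. x extreme_point_of (convex hull X)} \<subseteq> convex hull {x \<in> X. private_point X x}"
    by (rule hull_mono)
  then show ?thesis
    using Krein_Milman_polytope[OF X] hull_subset[of X convex] by auto
qed

lemma continuous_on_Max_finite:
  fixes g :: "'a \<Rightarrow> 'b::topological_space \<Rightarrow> real"
  assumes "finite X" "X \<noteq> {}" "\<And>x. x \<in> X \<Longrightarrow> continuous_on S (g x)"
  shows "continuous_on S (\<lambda>z. Max ((\<lambda>x. g x z) ` X))"
  using assms
proof (induction X rule: finite_ne_induct)
  case (singleton x)
  then show ?case by simp
next
  case (insert x F)
  then have "continuous_on S (\<lambda>z. max (g x z) (Max ((\<lambda>x. g x z) ` F)))"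
    by (intro continuous_on_max) auto
  then show ?case
    using insert by simp
qed

text \<open>The centre of the smallest enclosing ball lies in the convex hull of the points on its
  boundary: otherwise moving the centre towards a separating hyperplane would bring all of these
  points closer, and the radius could be reduced.\<close>
lemma minimal_enclosing_ball:
  fixes X :: "'a::euclidean_space set"
  assumes X: "finite X" "X \<noteq> {}"
  obtains z r where "X \<subseteq> cball z r" "z \<in> convex hull {x \<in> X. norm (x - z) = r}"
proof -
  define f where "f z = Max ((\<lambda>x. norm (x - z)) ` X)" for z
  have f_ge: "norm (x - z) \<le> f z" if "x \<in> X" for x z
    unfolding f_def using X that by (intro Max_ge) auto
  obtain x0 where x0: "x0 \<in> X"
    using X by blast
  have "continuous_on S f" for S
    unfolding f_def using X by (intro continuous_on_Max_finite continuous_intros) auto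
  then have "continuous_on (cball x0 (f x0)) f" .
  moreover have "0 \<le> f x0"
    using f_ge[OF x0, of x0] by simp
  then have "cball x0 (f x0) \<noteq> {}"
    by simp
  ultimately obtain z where z: "z \<in> cball x0 (f x0)" "\<And>y. y \<in> cball x0 (f x0) \<Longrightarrow> f z \<le> f y"
    using continuous_attains_inf[OF compact_cball] by blast
  have min: "f z \<le> f y" for y
  proof (cases "y \<in> cball x0 (f x0)")
    case False
    then have "f x0 < norm (x0 - y)"
      by (simp add: dist_norm)
    then show ?thesis
      using f_ge[OF x0, of y] z(2)[of x0] \<open>0 \<le> f x0\<close> by simp
  qed (rule z(2))
  define r where "r = f z"
  define T where "T = {x \<in> X. norm (x - z) = r}"
  have "z \<in> convex hull T"
  proof (rule ccontr)
    assume "z \<notin> convex hull T"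
    moreover have "closed (convex hull T)"
      using X by (simp add: T_def compact_imp_closed finite_imp_compact_convex_hull)
    ultimately have "\<exists>a b. a \<bullet> z < b \<and> (\<forall>y\<in>convex hull T. a \<bullet> y > b)"
      by (intro separating_hyperplane_closed_point convex_convex_hull)
    then obtain a b where ab: "a \<bullet> z < b" "\<And>y. y \<in> convex hull T \<Longrightarrow> a \<bullet> y > b"
      by blast
    have T: "a \<bullet> (x - z) > 0" if "x \<in> T" for x
      using ab(1) ab(2)[OF hull_inc[OF that]] by (simp add: inner_diff_right)
    have "f z \<in> (\<lambda>x. norm (x - z)) ` X"
      unfolding f_def using X by (intro Max_in) auto
    then obtain t where "t \<in> T"
      by (auto simp: T_def r_def)
    then have a: "a \<noteq> 0"
      using T by fastforce
    have "\<forall>\<^sub>F \<epsilon> in at_right 0. norm (x - (z + \<epsilon> *\<^sub>R a)) < r" if x: "x \<in> X" for x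
    proof (cases "x \<in> T")
      case True
      have "\<forall>\<^sub>F \<epsilon> in at_right 0. \<epsilon> < 2 * (a \<bullet> (x - z)) / (a \<bullet> a)"
        using T[OF True] a by (intro eventually_at_rightI[of 0 "2 * (a \<bullet> (x - z)) / (a \<bullet> a)"]) auto
      moreover have "\<forall>\<^sub>F \<epsilon> in at_right (0::real). \<epsilon> > 0"
        by (rule eventually_at_right_less)
      ultimately show ?thesis
      proof eventually_elim
        case (elim \<epsilon>)
        then have "\<epsilon> * (\<epsilon> * (a \<bullet> a)) < \<epsilon> * (2 * (a \<bullet> (x - z)))"
          using a by (simp add: field_simps)
        moreover have "(norm (x - (z + \<epsilon> *\<^sub>R a)))\<^sup>2
            = (norm (x - z))\<^sup>2 - \<epsilon> * (2 * (a \<bullet> (x - z))) + \<epsilon> * (\<epsilon> * (a \<bullet> a))"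
          by (simp add: power2_norm_eq_inner inner_diff_left inner_diff_right inner_add_left
              inner_add_right inner_commute algebra_simps)
        moreover have "norm (x - z) = r"
          using True by (simp add: T_def)
        ultimately have "(norm (x - (z + \<epsilon> *\<^sub>R a)))\<^sup>2 < r\<^sup>2"
          by simp
        then show ?case
          using \<open>norm (x - z) = r\<close> by (auto intro: power2_less_imp_less)
      qed
    next
      case False
      then have "norm (x - z) < r"
        using f_ge[OF x, of z] x by (simp add: T_def r_def)
      then have "\<forall>\<^sub>F \<epsilon> in at_right 0. \<epsilon> < (r - norm (x - z)) / norm a"
        using a by (intro eventually_at_rightI[of 0 "(r - norm (x - z)) / norm a"]) auto
      moreover have "\<forall>\<^sub>F \<epsilon> in at_right (0::real). \<epsilon> > 0"
        by (rule eventually_at_right_less)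
      ultimately show ?thesis
      proof eventually_elim
        case (elim \<epsilon>)
        then have "\<epsilon> * norm a < r - norm (x - z)"
          using a by (simp add: field_simps)
        then show ?case
          using norm_triangle_ineq4[of "x - z" "\<epsilon> *\<^sub>R a"] elim by (simp add: algebra_simps)
      qed
    qed
    then have "\<forall>\<^sub>F \<epsilon> in at_right 0. \<forall>x\<in>X. norm (x - (z + \<epsilon> *\<^sub>R a)) < r"
      using X(1) by (simp add: eventually_ball_finite)
    then obtain \<epsilon> where "\<forall>x\<in>X. norm (x - (z + \<epsilon> *\<^sub>R a)) < r"
      using eventually_happens[of _ "at_right (0::real)"] by auto
    then have "f (z + \<epsilon> *\<^sub>R a) < r"
      unfolding f_def using X by simp
    then show False
      using min[of "z + \<epsilon> *\<^sub>R a"] by (simp add: r_def)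
  qed
  moreover have "X \<subseteq> cball z r"
    using f_ge by (auto simp: r_def dist_norm norm_minus_commute)
  ultimately show ?thesis
    using that unfolding T_def by blast
qed

section \<open>Four private points\<close>

text \<open>Consider the circles through a and b. Moving the centre away from the triangle, starting with the
  circle around k, shrinks the part of the disk on the side of X. The last circle that
  passes through a point p of X other than a, b and c bounds an empty disk. Its radius is
  at least \<open>r > 1\<close>, as the centre only moved further away from the line ab, so p is private. The
  corner c causes no trouble: the disk through a, b and c contains the triangle, hence the circle of
  every other point comes after that of c. A point on the line ab is private for the simpler reason that
  this is a supporting line.\<close>
lemma private_point_facing_edge:
  fixes a b c k n q :: "real^2"
  assumes X: "finite X" and hull: "X \<subseteq> convex hull {a, b, c}"
    and q: "q \<in> X" "q \<notin> {a, b, c}"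
    and n: "n \<noteq> 0" "n \<bullet> b = n \<bullet> a" "n \<bullet> c \<le> n \<bullet> a"
    and k: "norm (a - k) = r" "norm (b - k) = r" "n \<bullet> a \<le> n \<bullet> k"
    and r: "r > 1" and qk: "norm (q - k) \<le> r"
  obtains p where "p \<in> X" "p \<notin> {a, b, c}" "private_point X p"
proof -
  have "convex hull {a, b, c} \<subseteq> {x. n \<bullet> x \<le> n \<bullet> a}"
    using n by (intro hull_minimal convex_halfspace_le) auto
  then have side: "n \<bullet> x \<le> n \<bullet> a" if "x \<in> X" for x
    using that hull by auto
  show ?thesis
  proof (cases "\<exists>x\<in>X - {a, b, c}. n \<bullet> x = n \<bullet> a")
    case True
    then obtain p where "p \<in> X" "p \<notin> {a, b, c}" "n \<bullet> p = n \<bullet> a"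
      by blast
    then show ?thesis
      using that private_if_maximal[OF X _ n(1)] side by metis
  next
    case False
    define Z where "Z = X - {a, b, c}"
    have Z: "finite Z" "q \<in> Z"
      using X q by (auto simp: Z_def)
    have inside: "n \<bullet> (a - x) > 0" if "x \<in> Z" for x
    proof -
      have "n \<bullet> x \<le> n \<bullet> a" "n \<bullet> x \<noteq> n \<bullet> a"
        using that False side by (auto simp: Z_def)
      then show ?thesis
        by (simp add: inner_diff_right)
    qed
    have inside_c: "n \<bullet> (a - c) > 0"
    proof (rule ccontr)
      assume "\<not> ?thesis"
      then have "convex hull {a, b, c} \<subseteq> {x. n \<bullet> x \<ge> n \<bullet> a}"
        using n by (intro hull_minimal convex_halfspace_ge) (auto simp: inner_diff_right)
      then show False
        using inside[OF Z(2)] q(1) hull by (auto simp: inner_diff_right)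
    qed
    \<comment> \<open>The circles through a and b have centres on the line k + t n, and s x is the parameter of
      the one through x.\<close>
    have power: "(norm (x - (k + t *\<^sub>R n)))\<^sup>2 - (norm (a - (k + t *\<^sub>R n)))\<^sup>2
        = (norm (x - k))\<^sup>2 - r\<^sup>2 + t * (2 * (n \<bullet> (a - x)))" for x t
      unfolding k(1)[symmetric] power2_norm_eq_inner
      by (simp add: inner_diff_left inner_diff_right inner_add_left inner_add_right
          inner_commute algebra_simps)
    define s where "s x = (r\<^sup>2 - (norm (x - k))\<^sup>2) / (2 * (n \<bullet> (a - x)))" for x
    have on_b: "norm (b - (k + t *\<^sub>R n)) = norm (a - (k + t *\<^sub>R n))" for t
      using power[of b t] k(2) n(2) by (simp add: inner_diff_right power2_eq_iff_nonneg)
    have s_c: "s c \<le> s q"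
    proof -
      define K where "K = k + s c *\<^sub>R n"
      have "s c * (2 * (n \<bullet> (a - c))) = r\<^sup>2 - (norm (c - k))\<^sup>2"
        using inside_c by (simp add: s_def)
      then have "(norm (c - K))\<^sup>2 = (norm (a - K))\<^sup>2"
        using power[of c "s c"] by (simp add: K_def)
      then have "norm (c - K) = norm (a - K)"
        by (simp add: power2_eq_iff_nonneg)
      then have "{a, b, c} \<subseteq> cball K (norm (a - K))"
        using on_b[of "s c"] by (auto simp: dist_norm norm_minus_commute K_def)
      then have "convex hull {a, b, c} \<subseteq> cball K (norm (a - K))"
        by (intro hull_minimal) auto
      then have "norm (q - K) \<le> norm (a - K)"
        using q(1) hull by (auto simp: dist_norm norm_minus_commute)
      then have "(norm (q - K))\<^sup>2 \<le> (norm (a - K))\<^sup>2"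
        by simp
      then have "s c * (2 * (n \<bullet> (a - q))) \<le> r\<^sup>2 - (norm (q - k))\<^sup>2"
        using power[of q "s c"] unfolding K_def by linarith
      then show ?thesis
        using inside[OF Z(2)] unfolding s_def[of q] by (simp add: pos_le_divide_eq)
    qed
    have "Max (s ` Z) \<in> s ` Z"
      using Z by (intro Max_in) auto
    then obtain p where p: "p \<in> Z" "s p = Max (s ` Z)"
      by auto
    have s_max: "s x \<le> s p" if "x \<in> Z" for x
      using p(2) Z that by simp
    \<comment> \<open>The centre of the last circle, which passes through p.\<close>
    define K where "K = k + s p *\<^sub>R n"
    have "(norm (q - k))\<^sup>2 \<le> r\<^sup>2"
      using qk by (simp add: power_mono)
    then have "s q \<ge> 0"
      using inside[OF Z(2)] by (simp add: s_def)
    then have sp: "s p \<ge> 0"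
      using s_max[OF Z(2)] by simp
    have outside: "norm (a - K) \<le> norm (x - K)" if x: "x = c \<or> x \<in> Z" for x
    proof -
      have pos: "n \<bullet> (a - x) > 0"
        using x inside inside_c by blast
      have "s x \<le> s p"
        using x s_c s_max[OF Z(2)] s_max by auto
      then have "r\<^sup>2 - (norm (x - k))\<^sup>2 \<le> s p * (2 * (n \<bullet> (a - x)))"
        using pos unfolding s_def[of x] by (simp add: pos_divide_le_eq)
      then have "(norm (a - K))\<^sup>2 \<le> (norm (x - K))\<^sup>2"
        using power[of x "s p"] unfolding K_def by linarith
      then show ?thesis
        by (rule power2_le_imp_le) simp
    qed
    have "s p * (2 * (n \<bullet> (a - p))) = r\<^sup>2 - (norm (p - k))\<^sup>2"
      using inside[OF p(1)] by (simp add: s_def)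
    then have "(norm (p - K))\<^sup>2 = (norm (a - K))\<^sup>2"
      using power[of p "s p"] unfolding K_def by simp
    then have on_p: "norm (p - K) = norm (a - K)"
      by (simp add: power2_eq_iff_nonneg)
    have "(norm (a - K))\<^sup>2 = r\<^sup>2 + 2 * s p * (n \<bullet> (k - a)) + (s p)\<^sup>2 * (n \<bullet> n)"
      unfolding k(1)[symmetric] power2_norm_eq_inner K_def
      by (simp add: inner_diff_left inner_diff_right inner_add_left inner_add_right
          inner_commute algebra_simps power2_eq_square)
    then have "r\<^sup>2 \<le> (norm (a - K))\<^sup>2"
      using sp k(3) by (simp add: inner_diff_right)
    then have large: "norm (a - K) \<ge> r"
      by (rule power2_le_imp_le) simp
    have "private_point X p"
    proof (rule private_if_on_empty_circle[OF X _ on_p])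
      show "p \<in> X"
        using p(1) by (simp add: Z_def)
      show "norm (a - K) > 1"
        using large r by simp
      show "norm (a - K) \<le> norm (x - K)" if "x \<in> X" for x
        using that outside[of x] on_b[of "s p"] by (cases "x \<in> Z") (auto simp: Z_def K_def)
    qed
    then show ?thesis
      using that p(1) unfolding Z_def by blast
  qed
qed

text \<open>Barycentric coordinates l are reduced by the largest multiple of the coordinates h that leaves
  them nonnegative. Geometrically, a point of a triangle lies in one of the three triangles
  spanned by an edge and a second given point of it.\<close>
lemma common_scaling_until_tight:
  fixes h1 h2 h3 l1 l2 l3 :: real
  assumes h: "h1 \<ge> 0" "h2 \<ge> 0" "h3 \<ge> 0" "h1 + h2 + h3 = 1"
    and l: "l1 \<ge> 0" "l2 \<ge> 0" "l3 \<ge> 0" "l1 + l2 + l3 = 1"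
  obtains \<tau> where "\<tau> \<ge> 0" "\<tau> * h1 \<le> l1" "\<tau> * h2 \<le> l2" "\<tau> * h3 \<le> l3"
    "\<tau> * h1 = l1 \<or> \<tau> * h2 = l2 \<or> \<tau> * h3 = l3"
proof -
  \<comment> \<open>The value for \<open>h = 0\<close> only has to be larger than all quotients, so that the minimum is attained
    where h is positive.\<close>
  define f where "f l h = (if h > 0 then l / h else 1 + l1 / h1 + l2 / h2 + l3 / h3)" for l h :: real
  define \<tau> where "\<tau> = min (f l1 h1) (min (f l2 h2) (f l3 h3))"
  have fh: "\<tau> * h \<le> l" if "\<tau> \<le> f l h" "h \<ge> 0" "l \<ge> 0" for l h
    using that by (cases "h = 0") (auto simp: f_def field_simps)
  have ft: "f l h * h = l" if "h > 0" for l h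
    using that by (simp add: f_def)
  have le: "\<tau> \<le> f l1 h1" "\<tau> \<le> f l2 h2" "\<tau> \<le> f l3 h3"
    by (auto simp: \<tau>_def)
  have frac: "l1 / h1 \<ge> 0" "l2 / h2 \<ge> 0" "l3 / h3 \<ge> 0"
    using h l by simp_all
  have "\<tau> * h1 = l1 \<or> \<tau> * h2 = l2 \<or> \<tau> * h3 = l3"
  proof (cases "h1 > 0 \<and> \<tau> = f l1 h1 \<or> h2 > 0 \<and> \<tau> = f l2 h2 \<or> h3 > 0 \<and> \<tau> = f l3 h3")
    case True
    then show ?thesis
      using ft by metis
  next
    case False
    have "\<tau> = f l1 h1 \<or> \<tau> = f l2 h2 \<or> \<tau> = f l3 h3"
      by (auto simp: \<tau>_def min_def)
    then have "\<tau> = 1 + l1 / h1 + l2 / h2 + l3 / h3"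
      using False by (auto simp: f_def)
    moreover have "h1 > 0 \<or> h2 > 0 \<or> h3 > 0"
      using h by auto
    ultimately show ?thesis
      using le frac by (auto simp: f_def split: if_splits)
  qed
  moreover have "\<tau> \<ge> 0"
    using h l frac by (auto simp: \<tau>_def f_def)
  moreover have "\<tau> * h1 \<le> l1" "\<tau> * h2 \<le> l2" "\<tau> * h3 \<le> l3"
    using h l le by (auto intro!: fh)
  ultimately show ?thesis
    using that by blast
qed

text \<open>The circumcircle (here around the origin), reflected in the edges of a triangle, yields
  three circles that all pass through the orthocentre S = a + b + c. If the circumcentre is in the
  triangle, then so is S, and each of the three triangles with vertex S is contained in
  the reflected disk of its edge.\<close>
lemma reflected_circumdisks_cover_triangle:
  fixes a b c q :: "'a::real_inner"
  assumes r: "norm a = r" "norm b = r" "norm c = r" and r0: "r > 0"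
    and centre: "0 \<in> convex hull {a, b, c}" and q: "q \<in> convex hull {a, b, c}"
  shows "norm (q - (a + b)) \<le> r \<or> norm (q - (b + c)) \<le> r \<or> norm (q - (c + a)) \<le> r"
proof -
  obtain \<alpha> \<beta> \<gamma> where w: "\<alpha> \<ge> 0" "\<beta> \<ge> 0" "\<gamma> \<ge> 0" "\<alpha> + \<beta> + \<gamma> = 1"
    and zero: "\<alpha> *\<^sub>R a + \<beta> *\<^sub>R b + \<gamma> *\<^sub>R c = 0"
    using centre by (auto simp: convex_hull_3)
  obtain l1 l2 l3 where l: "l1 \<ge> 0" "l2 \<ge> 0" "l3 \<ge> 0" "l1 + l2 + l3 = 1"
    and q_eq: "q = l1 *\<^sub>R a + l2 *\<^sub>R b + l3 *\<^sub>R c"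
    using q by (auto simp: convex_hull_3)
  \<comment> \<open>By the triangle inequality no barycentric coordinate of the circumcentre exceeds 1/2, so that
    the coordinates \<open>1 - 2 \<alpha>\<close>, \<open>1 - 2 \<beta>\<close> and \<open>1 - 2 \<gamma>\<close> of S are nonnegative.\<close>
  have half: "x \<le> 1/2" if "x \<ge> 0" "y \<ge> 0" "z \<ge> 0" "x + y + z = 1" "norm u = r" "norm v = r"
    "norm w = r" "x *\<^sub>R u + y *\<^sub>R v + z *\<^sub>R w = 0" for x y z and u v w :: 'a
  proof -
    have "x *\<^sub>R u = - (y *\<^sub>R v + z *\<^sub>R w)"
      using that(8) by (subst eq_neg_iff_add_eq_0) (simp add: add.assoc)
    then have "norm (x *\<^sub>R u) = norm (y *\<^sub>R v + z *\<^sub>R w)"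
      by (metis norm_minus_cancel)
    also have "\<dots> \<le> norm (y *\<^sub>R v) + norm (z *\<^sub>R w)"
      by (rule norm_triangle_ineq)
    finally have "x * r \<le> (y + z) * r"
      using that by (simp add: distrib_right)
    then show ?thesis
      using r0 that(4) by simp
  qed
  have "\<alpha> \<le> 1/2" "\<beta> \<le> 1/2" "\<gamma> \<le> 1/2"
    using half[of \<alpha> \<beta> \<gamma> a b c] half[of \<beta> \<gamma> \<alpha> b c a] half[of \<gamma> \<alpha> \<beta> c a b] w r zero
    by (simp_all add: add.assoc add.commute add.left_commute)
  then have h: "1 - 2 * \<alpha> \<ge> 0" "1 - 2 * \<beta> \<ge> 0" "1 - 2 * \<gamma> \<ge> 0"
    "(1 - 2 * \<alpha>) + (1 - 2 * \<beta>) + (1 - 2 * \<gamma>) = 1"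
    using w by simp_all
  obtain \<tau> where \<tau>: "\<tau> \<ge> 0" "\<tau> * (1 - 2 * \<alpha>) \<le> l1" "\<tau> * (1 - 2 * \<beta>) \<le> l2" "\<tau> * (1 - 2 * \<gamma>) \<le> l3"
    "\<tau> * (1 - 2 * \<alpha>) = l1 \<or> \<tau> * (1 - 2 * \<beta>) = l2 \<or> \<tau> * (1 - 2 * \<gamma>) = l3"
    using common_scaling_until_tight[OF h l] .
  define S where "S = a + b + c"
  define x y z where "x = l1 - \<tau> * (1 - 2 * \<alpha>)" and "y = l2 - \<tau> * (1 - 2 * \<beta>)"
    and "z = l3 - \<tau> * (1 - 2 * \<gamma>)"
  have xyz: "x \<ge> 0" "y \<ge> 0" "z \<ge> 0" "x = 0 \<or> y = 0 \<or> z = 0" "\<tau> + x + y + z = 1"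
  proof -
    have "x + y + z = (l1 + l2 + l3) - \<tau> * ((1 - 2 * \<alpha>) + (1 - 2 * \<beta>) + (1 - 2 * \<gamma>))"
      by (simp only: x_def y_def z_def distrib_left)
    also have "\<dots> = 1 - \<tau>"
      unfolding h(4) l(4) by simp
    finally show "\<tau> + x + y + z = 1"
      by simp
  qed (use \<tau> in \<open>auto simp: x_def y_def z_def\<close>)
  have "(1 - 2 * \<alpha>) *\<^sub>R a + (1 - 2 * \<beta>) *\<^sub>R b + (1 - 2 * \<gamma>) *\<^sub>R c
      = S - 2 *\<^sub>R (\<alpha> *\<^sub>R a + \<beta> *\<^sub>R b + \<gamma> *\<^sub>R c)"
    by (simp add: S_def algebra_simps)
  then have S: "S = (1 - 2 * \<alpha>) *\<^sub>R a + (1 - 2 * \<beta>) *\<^sub>R b + (1 - 2 * \<gamma>) *\<^sub>R c"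
    using zero by simp
  have q_S: "q = \<tau> *\<^sub>R S + x *\<^sub>R a + y *\<^sub>R b + z *\<^sub>R c"
    unfolding S q_eq x_def y_def z_def by (simp add: algebra_simps)
  have reach: "norm (\<tau> *\<^sub>R (u + v + w) + d *\<^sub>R u + e *\<^sub>R v - (u + v)) \<le> r"
    if "norm u = r" "norm v = r" "norm w = r" "d \<ge> 0" "e \<ge> 0" "\<tau> + d + e = 1" for d e and u v w :: 'a
  proof -
    have "\<tau> *\<^sub>R (u + v + w) + d *\<^sub>R u + e *\<^sub>R v - (\<tau> + d + e) *\<^sub>R (u + v) = \<tau> *\<^sub>R w - d *\<^sub>R v - e *\<^sub>R u"
      by (simp add: algebra_simps)
    then have "norm (\<tau> *\<^sub>R (u + v + w) + d *\<^sub>R u + e *\<^sub>R v - (u + v)) = norm (\<tau> *\<^sub>R w - d *\<^sub>R v - e *\<^sub>R u)"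
      using that(6) by simp
    also have "\<dots> \<le> norm (\<tau> *\<^sub>R w) + norm (d *\<^sub>R v) + norm (e *\<^sub>R u)"
      using norm_triangle_ineq4[of "\<tau> *\<^sub>R w - d *\<^sub>R v" "e *\<^sub>R u"] norm_triangle_ineq4[of "\<tau> *\<^sub>R w" "d *\<^sub>R v"]
      by linarith
    also have "\<dots> = (\<tau> + d + e) * r"
      using that(1-5) \<tau>(1) by (simp add: distrib_right)
    finally show ?thesis
      using that(6) by simp
  qed
  from xyz(4) show ?thesis
  proof (elim disjE)
    assume "x = 0"
    then show ?thesis
      using reach[of b c a y z] xyz r by (simp add: q_S S_def ac_simps)
  next
    assume "y = 0"
    then show ?thesis
      using reach[of c a b z x] xyz r by (simp add: q_S S_def ac_simps)
  next
    assume "z = 0"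
    then show ?thesis
      using reach[of a b c x y] xyz r by (simp add: q_S S_def ac_simps)
  qed
qed

lemma edge_normal:
  fixes a b c :: "real^2"
  assumes "a \<noteq> b"
  obtains n where "n \<noteq> 0" "n \<bullet> b = n \<bullet> a" "n \<bullet> c \<le> n \<bullet> a"
proof -
  define m :: "real^2" where "m = vector [a $ 2 - b $ 2, b $ 1 - a $ 1]"
  have m: "m \<noteq> 0" "m \<bullet> b = m \<bullet> a"
    using assms by (auto simp: m_def vec_eq_iff forall_2 vector_2 inner_vec_def sum_2 algebra_simps)
  show ?thesis
  proof (cases "m \<bullet> c \<le> m \<bullet> a")
    case True
    then show ?thesis
      using that m by blast
  next
    case False
    then show ?thesis
      using that[of "- m"] m by simp
  qed
qed

text \<open>Let z and r > 1 be the centre and radius of the smallest enclosing disk. All points on its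
  boundary and all vertices of the convex hull are private. If there are at most three private points,
  some point q is not private, and X lies in a triangle with private corners. Two cases
  remain. If the boundary holds two points a and b, they are antipodal, and
  the disk itself serves as first disk for the edge ab. If it holds the three corners, then a
  reflection of the disk in one of the edges contains q and serves as first disk for this edge.
  In both cases \<open>private_point_facing_edge\<close> yields one more private point.\<close>
lemma four_private_points:
  assumes X: "finite X" and card: "card X \<ge> 4" and wide: "\<And>z. \<not> X \<subseteq> cball z 1"
  shows "card {x \<in> X. private_point X x} \<ge> 4"
proof (rule ccontr)
  assume few: "\<not> ?thesis"
  define P where "P = {x \<in> X. private_point X x}"
  have P: "finite P" "card P \<le> 3" "P \<subseteq> X"
    using X few by (auto simp: P_def)
  have "X \<noteq> {}"
    using card by auto
  then obtain z r where zr: "X \<subseteq> cball z r" "z \<in> convex hull {x \<in> X. norm (x - z) = r}"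
    using minimal_enclosing_ball[OF X] by blast
  have r: "r > 1"
    using zr(1) wide[of z] by (meson linorder_not_less order_trans subset_cball)
  define T where "T = {x \<in> X. norm (x - z) = r}"
  have T: "T \<subseteq> P" "finite T" "z \<in> convex hull T" "\<And>x. x \<in> T \<Longrightarrow> norm (x - z) = r"
    using private_if_on_enclosing_circle[OF X _ zr(1)] r X zr(2) by (auto simp: T_def P_def)
  have hull_P: "X \<subseteq> convex hull P"
    using subset_hull_of_private_points[OF X] by (simp add: P_def)
  have "card P < card X"
    using P card by simp
  then have "\<exists>q. q \<in> X \<and> q \<notin> P"
    using P by (metis card_mono not_less subsetI)
  then obtain q where q: "q \<in> X" "q \<notin> P"
    by blast
  have qz: "norm (q - z) \<le> r"
    using zr(1) q(1) by (auto simp: dist_norm norm_minus_commute)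
  have no_facing: False if abc: "P \<subseteq> {a, b, c}" "q \<notin> {a, b, c}" and nk: "n \<noteq> 0" "n \<bullet> b = n \<bullet> a" "n \<bullet> c \<le> n \<bullet> a"
    "norm (a - k) = r" "norm (b - k) = r" "n \<bullet> a \<le> n \<bullet> k" "norm (q - k) \<le> r" for a b c n k
  proof -
    have "X \<subseteq> convex hull {a, b, c}"
      using hull_P hull_mono[OF abc(1)] by blast
    then obtain p where "p \<in> X" "p \<notin> {a, b, c}" "private_point X p"
      using private_point_facing_edge[OF X _ q(1) abc(2) nk(1-6) r nk(7)] by metis
    then show False
      using abc(1) by (auto simp: P_def)
  qed
  have "card T \<le> 3"
    using card_mono[OF P(1) T(1)] P(2) by simp
  moreover have "card T \<noteq> 0"
    using T(2,3) by auto
  moreover have "card T \<noteq> 1"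
    using T(3,4) r by (auto simp: card_1_singleton_iff)
  ultimately consider "card T = 2" | "card T = 3"
    by linarith
  then show False
  proof cases
    case 1
    then obtain a b where ab: "T = {a, b}" "a \<noteq> b"
      by (auto simp: card_2_iff)
    have "card (P - {a, b}) \<le> 1"
      using P T(1) ab card_Diff_subset[of "{a, b}" P] by simp
    then obtain c where c: "P - {a, b} \<subseteq> {c}" "c \<in> P"
      using T(1) ab(1) P(1) by (cases "P - {a, b} = {}") (auto simp: card_le_Suc0_iff_eq)
    obtain n where n: "n \<noteq> 0" "n \<bullet> b = n \<bullet> a" "n \<bullet> c \<le> n \<bullet> a"
      using edge_normal[OF ab(2)] .
    have "convex hull T \<subseteq> {x. n \<bullet> x \<ge> n \<bullet> a}"
      using ab(1) n by (intro hull_minimal convex_halfspace_ge) auto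
    then have "n \<bullet> a \<le> n \<bullet> z"
      using T(3) by auto
    moreover have "norm (a - z) = r" "norm (b - z) = r"
      using T(4) ab(1) by auto
    ultimately show False
      using no_facing[OF _ _ n, of z] c T(1) ab(1) q(2) qz by auto
  next
    case 2
    then have TP: "T = P"
      using P T(1) by (simp add: card_seteq)
    obtain a b c where abc: "T = {a, b, c}" "a \<noteq> b" "b \<noteq> c" "c \<noteq> a"
      using 2 by (auto simp: card_3_iff)
    have shift: "y - z \<in> convex hull {a - z, b - z, c - z}" if "y \<in> convex hull T" for y
    proof -
      have "(\<lambda>x. x - z) ` (convex hull T) = convex hull ((\<lambda>x. x - z) ` T)"
        using convex_hull_translation[of "- z" T] by simp
      also have "(\<lambda>x. x - z) ` T = {a - z, b - z, c - z}"
        by (simp add: abc(1))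
      finally show ?thesis
        using that by blast
    qed
    have zero: "0 \<in> convex hull {a - z, b - z, c - z}"
      using shift[OF T(3)] by simp
    have "norm (a - z) = r" "norm (b - z) = r" "norm (c - z) = r" "0 < r"
      using T(4) abc(1) r by auto
    moreover have "q - z \<in> convex hull {a - z, b - z, c - z}"
      using shift q(1) hull_P TP by blast
    ultimately have "norm ((q - z) - ((a - z) + (b - z))) \<le> r \<or> norm ((q - z) - ((b - z) + (c - z))) \<le> r
        \<or> norm ((q - z) - ((c - z) + (a - z))) \<le> r"
      using reflected_circumdisks_cover_triangle[OF _ _ _ _ zero] by blast
    moreover have False
      if uvw: "P = {u, v, w}" "u \<noteq> v" "norm ((q - z) - ((u - z) + (v - z))) \<le> r" for u v w
    proof -
      obtain n where n: "n \<noteq> 0" "n \<bullet> v = n \<bullet> u" "n \<bullet> w \<le> n \<bullet> u"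
        using edge_normal[OF uvw(2)] .
      have "convex hull T \<subseteq> {x. n \<bullet> x \<le> n \<bullet> u}"
        using uvw(1) TP n by (intro hull_minimal convex_halfspace_le) auto
      then have "n \<bullet> z \<le> n \<bullet> u"
        using T(3) by auto
      then have "n \<bullet> u \<le> n \<bullet> (u + v - z)"
        using n by (simp add: inner_add_right inner_diff_right)
      moreover have "norm (u - z) = r" "norm (v - z) = r"
        using T(4) TP uvw(1) by auto
      then have "norm (u - (u + v - z)) = r" "norm (v - (u + v - z)) = r"
        by (simp_all add: norm_minus_commute)
      moreover have "norm (q - (u + v - z)) \<le> r"
        using uvw(3) by (simp add: algebra_simps)
      ultimately show False
        using no_facing[OF _ _ n, of "u + v - z"] uvw(1) q(2) by auto
    qed
    from this[of a b c] this[of b c a] this[of c a b] have "\<not> norm ((q - z) - ((a - z) + (b - z))) \<le> r"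
      "\<not> norm ((q - z) - ((b - z) + (c - z))) \<le> r" "\<not> norm ((q - z) - ((c - z) + (a - z))) \<le> r"
      using TP abc by auto
    ultimately show False
      by blast
  qed
qed

section \<open>The hexagonal arrangement\<close>
lemma emeasure_lborel_vec2:
  fixes A :: "(real^2) set"
  assumes A: "A \<in> sets borel"
  shows "emeasure lborel A = (\<integral>\<^sup>+y. emeasure lborel {x. vector [x, y] \<in> A} \<partial>lborel)"
proof -
  define g :: "real \<times> real \<Rightarrow> real^2" where "g p = fst p *\<^sub>R axis 1 1 + snd p *\<^sub>R axis 2 1" for p
  have g_nth: "g p $ 1 = fst p" "g p $ 2 = snd p" for p
    by (simp_all add: g_def axis_def)
  have g_vec: "g (x, y) = vector [x, y]" for x y
    by (simp add: vec_eq_iff forall_2 g_nth vector_2)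
  have g_meas: "g \<in> borel_measurable borel"
    unfolding g_def by (intro borel_measurable_continuous_onI continuous_intros)
  have "lborel = distr lborel borel g"
  proof (rule lborel_eqI)
    fix l u :: "real^2"
    assume le: "\<And>b. b \<in> Basis \<Longrightarrow> l \<bullet> b \<le> u \<bullet> b"
    have basis: "(Basis :: (real^2) set) = {axis 1 1, axis 2 1}"
      by (auto simp: Basis_vec_def UNIV_2)
    have neq: "axis 1 1 \<noteq> (axis 2 1 :: real^2)"
      by (simp add: axis_eq_axis)
    have le': "l $ 1 \<le> u $ 1" "l $ 2 \<le> u $ 2"
      using le[of "axis 1 1"] le[of "axis 2 1"] by (simp_all add: basis inner_axis)
    have "g -` box l u = box (l $ 1) (u $ 1) \<times> box (l $ 2) (u $ 2)"
      by (auto simp: mem_box_cart forall_2 g_nth)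
    then have "emeasure (distr lborel borel g) (box l u)
        = emeasure (lborel \<Otimes>\<^sub>M lborel) (box (l $ 1) (u $ 1) \<times> box (l $ 2) (u $ 2))"
      using g_meas by (simp add: emeasure_distr lborel_prod)
    also have "\<dots> = ennreal (u $ 1 - l $ 1) * ennreal (u $ 2 - l $ 2)"
      using le' by (simp add: lborel.emeasure_pair_measure_Times)
    also have "\<dots> = ennreal (\<Prod>b\<in>Basis. (u - l) \<bullet> b)"
      using le' neq by (simp add: basis inner_axis ennreal_mult)
    finally show "emeasure (distr lborel borel g) (box l u) = ennreal (\<Prod>b\<in>Basis. (u - l) \<bullet> b)" .
  qed simp
  then have "emeasure lborel A = emeasure (distr lborel borel g) A"
    by simp
  also have "\<dots> = emeasure (lborel \<Otimes>\<^sub>M lborel) (g -` A)"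
    using g_meas A by (simp add: emeasure_distr lborel_prod)
  also have "\<dots> = (\<integral>\<^sup>+y. emeasure lborel ((\<lambda>x. (x, y)) -` (g -` A)) \<partial>lborel)"
  proof (rule lborel_pair.emeasure_pair_measure_alt2)
    show "g -` A \<in> sets (lborel \<Otimes>\<^sub>M lborel)"
      unfolding lborel_prod using measurable_sets[OF g_meas A] by simp
  qed
  also have "(\<lambda>y. (\<lambda>x. (x, y)) -` (g -` A)) = (\<lambda>y. {x. vector [x, y] \<in> A})"
    by (auto simp: g_vec fun_eq_iff)
  finally show ?thesis .
qed

text \<open>This value of the spacing nearly minimises the expected number of bad points. Moreover
  \<open>1 - spacing / 2 = (6/25)\<^sup>2 / 2\<close>, which makes the area below rational.\<close>
definition spacing :: real where "spacing = 1214/625"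

text \<open>The parabola \<open>x = 1 - y\<^sup>2 / 2\<close> osculates the unit circle at its rightmost point and encloses
  it. It meets the line \<open>x = spacing / 2\<close> at \<open>\<bar>y\<bar> = 6/25\<close>.\<close>
lemma parabolic_segment_area:
  defines "P \<equiv> {y :: real^2. spacing / 2 \<le> y $ 1 \<and> y $ 1 \<le> 1 - (y $ 2)\<^sup>2 / 2}"
  shows "P \<in> lmeasurable" "measure lebesgue P \<le> 144/15625"
proof -
  have "closed P"
    unfolding P_def by (intro closed_Collect_conj closed_Collect_le continuous_intros) simp
  then have P: "P \<in> sets borel"
    by simp
  define f :: "real \<Rightarrow> real" where "f y = 18/625 - y\<^sup>2 / 2" for y
  have "emeasure lborel {x. vector [x, y] \<in> P} = ennreal (f y) * indicator {- (6/25)..6/25} y" for y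
  proof -
    have "{x. vector [x, y] \<in> P} = {607/625..1 - y\<^sup>2 / 2}"
      by (auto simp: P_def vector_2 spacing_def)
    moreover have "y \<in> {- (6/25)..6/25} \<longleftrightarrow> 0 \<le> f y"
    proof -
      have "0 \<le> f y \<longleftrightarrow> y\<^sup>2 \<le> (6/25)\<^sup>2"
        by (simp add: f_def power2_eq_square)
      also have "\<dots> \<longleftrightarrow> \<bar>y\<bar> \<le> 6/25"
        using abs_le_square_iff[of y "6/25"] by simp
      finally show ?thesis
        by auto
    qed
    ultimately show ?thesis
      by (cases "0 \<le> f y") (auto simp: f_def)
  qed
  then have "emeasure lborel P = (\<integral>\<^sup>+y. ennreal (f y) * indicator {- (6/25)..6/25} y \<partial>lborel)"
    by (simp add: emeasure_lborel_vec2[OF P])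
  also have "\<dots> = ennreal (18/625 * (6/25) - (6/25)^3 / 6 - (18/625 * (- (6/25)) - (- (6/25))^3 / 6))"
  proof (rule nn_integral_FTC_Icc[where F = "\<lambda>y. 18/625 * y - y^3 / 6"])
    show "f \<in> borel_measurable borel"
      unfolding f_def by measurable
    show "((\<lambda>y. 18/625 * y - y^3 / 6) has_real_derivative f x) (at x)" for x
      unfolding f_def by (auto intro!: derivative_eq_intros simp: power2_eq_square)
    fix x :: real assume "x \<in> {- (6/25)..6/25}"
    then have "\<bar>x\<bar> \<le> \<bar>6/25\<bar>"
      by auto
    then have "x\<^sup>2 \<le> (6/25)\<^sup>2"
      by (simp only: abs_le_square_iff)
    then show "0 \<le> f x"
      by (simp add: f_def power2_eq_square)
  qed simp
  also have "\<dots> = ennreal (144/15625)"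
    by (simp add: power3_eq_cube)
  finally have "emeasure lborel P = ennreal (144/15625)" .
  then have e: "emeasure lebesgue P = ennreal (144/15625)"
    using P by simp
  then show "P \<in> lmeasurable"
    using P by (intro fmeasurableI) auto
  show "measure lebesgue P \<le> 144/15625"
    using e by (simp add: measure_def)
qed

text \<open>The half of the lens of the unit disks around 0 and e that is closer to e. It is a
  circular segment of the disk around 0, and all of it is contained in the disk around e.\<close>
definition cap :: "real^2 \<Rightarrow> (real^2) set" where
  "cap e = {y. norm y < 1 \<and> e \<bullet> e / 2 \<le> e \<bullet> y}"

lemma cap_measurable: "cap e \<in> lmeasurable"
proof -
  have "cap e = ball 0 1 \<inter> {y. e \<bullet> e / 2 \<le> e \<bullet> y}"
    by (auto simp: cap_def)
  moreover have "{y. e \<bullet> e / 2 \<le> e \<bullet> y} \<in> sets lebesgue"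
    by (simp add: closed_halfspace_ge lmeasurable_iff_integrable_on)
  ultimately show ?thesis
    by (simp add: fmeasurable_Int_fmeasurable)
qed

text \<open>After a rotation that takes e to the first axis, the segment is enclosed by the parabola.
  The excess area is so small that the estimate suffices for \<open>good_translation\<close>.\<close>
lemma cap_area:
  assumes e: "norm e = spacing"
  shows "measure lebesgue (cap e) \<le> 144/15625"
proof -
  have "norm e = norm (spacing *\<^sub>R axis 1 1 :: real^2)"
    using e by (simp add: spacing_def)
  then obtain f :: "real^2 \<Rightarrow> real^2"
    where f: "orthogonal_transformation f" "f e = spacing *\<^sub>R axis 1 1"
    by (rule orthogonal_transformation_exists)
  have "f ` cap e \<subseteq> {y. spacing / 2 \<le> y $ 1 \<and> y $ 1 \<le> 1 - (y $ 2)\<^sup>2 / 2}"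
  proof clarify
    fix y assume y: "y \<in> cap e"
    define z where "z = f y"
    have "norm z < 1"
      using y f(1) by (simp add: z_def cap_def orthogonal_transformation_norm)
    then have "z \<bullet> z < 1"
      by (simp add: norm_lt_square)
    then have z: "(z $ 1)\<^sup>2 + (z $ 2)\<^sup>2 < 1"
      by (simp add: inner_vec_def sum_2 power2_eq_square)
    have "e \<bullet> e / 2 \<le> f e \<bullet> z"
      using y f(1) by (simp add: z_def cap_def orthogonal_transformation_def)
    then have z1: "spacing / 2 \<le> z $ 1"
      using e by (simp add: f(2) inner_axis' dot_square_norm power2_eq_square spacing_def)
    have "(1 - (z $ 2)\<^sup>2 / 2)\<^sup>2 = 1 - (z $ 2)\<^sup>2 + ((z $ 2)\<^sup>2 / 2)\<^sup>2"
      by (simp add: power2_eq_square algebra_simps)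
    then have "(z $ 1)\<^sup>2 \<le> (1 - (z $ 2)\<^sup>2 / 2)\<^sup>2"
      using z zero_le_power2[of "(z $ 2)\<^sup>2 / 2"] by linarith
    moreover have "0 \<le> 1 - (z $ 2)\<^sup>2 / 2"
      using z zero_le_power2[of "z $ 1"] by linarith
    ultimately have "z $ 1 \<le> 1 - (z $ 2)\<^sup>2 / 2"
      by (rule power2_le_imp_le)
    then show "spacing / 2 \<le> f y $ 1 \<and> f y $ 1 \<le> 1 - (f y $ 2)\<^sup>2 / 2"
      using z1 by (simp add: z_def)
  qed
  then have "measure lebesgue (f ` cap e) \<le> 144/15625"
    using parabolic_segment_area measurable_orthogonal_image[OF f(1) cap_measurable]
    by (meson fmeasurableD measure_mono_fmeasurable order_trans)
  then show ?thesis
    by (simp add: measure_orthogonal_image[OF f(1) cap_measurable])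
qed

definition row_height :: real where "row_height = spacing * sqrt 3 / 2"

definition lattice_point :: "int \<times> int \<Rightarrow> real^2" where
  "lattice_point p = vector [spacing * fst p + spacing / 2 * snd p, row_height * snd p]"

text \<open>A rectangular fundamental domain of the lattice. It is more convenient than the parallelogram
  spanned by the basis vectors, as its area is that of a box.\<close>
definition cell :: "(real^2) set" where
  "cell = {t. 0 \<le> t $ 1 \<and> t $ 1 < spacing \<and> 0 \<le> t $ 2 \<and> t $ 2 < row_height}"

definition neighbours :: "(int \<times> int) set" where
  "neighbours = {(1, 0), (-1, 0), (0, 1), (0, -1), (1, -1), (-1, 1)}"

lemma lattice_point_diff: "lattice_point (p - q) = lattice_point p - lattice_point q"
  by (simp add: lattice_point_def vec_eq_iff forall_2 vector_2 algebra_simps)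

lemma lattice_point_minus: "lattice_point (- p) = - lattice_point p"
  by (simp add: lattice_point_def vec_eq_iff forall_2 vector_2)

lemma lattice_point_inner:
  "lattice_point p \<bullet> lattice_point p = spacing\<^sup>2 * of_int ((fst p)\<^sup>2 + fst p * snd p + (snd p)\<^sup>2)"
proof -
  have "(spacing * sqrt 3 / 2 * j) * (spacing * sqrt 3 / 2 * j) = spacing\<^sup>2 * (3/4) * j\<^sup>2" for j
    by (simp add: power2_eq_square)
  then show ?thesis
    by (simp add: lattice_point_def inner_vec_def sum_2 vector_2 row_height_def)
      (simp add: power2_eq_square algebra_simps)
qed

lemma norm_lattice_neighbour:
  assumes "e \<in> neighbours"
  shows "norm (lattice_point e) = spacing"
proof -
  have "lattice_point e \<bullet> lattice_point e = spacing\<^sup>2"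
    using assms by (auto simp: lattice_point_inner neighbours_def)
  then show ?thesis
    by (simp add: norm_eq_sqrt_inner spacing_def)
qed

text \<open>Squared distances of lattice points are multiples of \<open>spacing\<^sup>2\<close> by values of the form
  \<open>i\<^sup>2 + i j + j\<^sup>2\<close>, and twice \<open>spacing\<^sup>2\<close> already exceeds 4.\<close>
lemma close_lattice_points_neighbours:
  assumes "p \<noteq> q" "norm (lattice_point p - lattice_point q) < 2"
  shows "p - q \<in> neighbours"
proof -
  obtain i j where ij: "p - q = (i, j)"
    by (cases "p - q")
  define m where "m = i\<^sup>2 + i * j + j\<^sup>2"
  have "lattice_point (p - q) \<bullet> lattice_point (p - q) < 2\<^sup>2"
    using assms(2) by (simp add: norm_lt_square lattice_point_diff)
  then have "spacing\<^sup>2 * of_int m < 4"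
    by (simp add: lattice_point_inner ij m_def)
  then have "m < 2"
    by (rule_tac ccontr) (simp add: spacing_def power2_eq_square)
  have four: "4 * m = (2 * i + j)\<^sup>2 + 3 * j\<^sup>2" "4 * m = (2 * j + i)\<^sup>2 + 3 * i\<^sup>2"
    by (simp_all add: m_def power2_eq_square algebra_simps)
  have sq: "x \<in> {-1, 0, 1}" if "x\<^sup>2 < 2\<^sup>2" for x :: int
  proof -
    have "\<bar>x\<bar> < 2"
      using that power_mono[of 2 "\<bar>x\<bar>" 2] by (cases "2 \<le> \<bar>x\<bar>") auto
    then show ?thesis
      by auto
  qed
  have "3 * j\<^sup>2 \<le> 4" "3 * i\<^sup>2 \<le> 4"
    using four zero_le_power2[of "2 * i + j"] zero_le_power2[of "2 * j + i"] \<open>m < 2\<close> by linarith+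
  then have "i \<in> {-1, 0, 1}" "j \<in> {-1, 0, 1}"
    using sq[of i] sq[of j] by simp_all
  moreover have "(i, j) \<noteq> (0, 0)"
    using assms(1) ij by (metis right_minus_eq zero_prod_def)
  ultimately show ?thesis
    using \<open>m < 2\<close> unfolding ij m_def neighbours_def by auto
qed

lemma spacing_pos: "spacing > 0" and row_height_pos: "row_height > 0"
  by (simp_all add: spacing_def row_height_def)

lemma cell_translates_cover: "\<exists>p. z - lattice_point p \<in> cell"
proof -
  define j where "j = \<lfloor>z $ 2 / row_height\<rfloor>"
  define i where "i = \<lfloor>(z $ 1 - spacing / 2 * j) / spacing\<rfloor>"
  have "real_of_int j \<le> z $ 2 / row_height" "z $ 2 / row_height < real_of_int j + 1"
    "real_of_int i \<le> (z $ 1 - spacing / 2 * j) / spacing" "(z $ 1 - spacing / 2 * j) / spacing < real_of_int i + 1"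
    unfolding i_def j_def by linarith+
  then have "z - lattice_point (i, j) \<in> cell"
    using spacing_pos row_height_pos
    by (simp add: cell_def lattice_point_def vector_2 pos_le_divide_eq pos_divide_less_eq algebra_simps)
  then show ?thesis
    by blast
qed

lemma cell_translates_disjoint:
  assumes "z - lattice_point p \<in> cell" "z - lattice_point q \<in> cell"
  shows "p = q"
proof -
  have unit: "k = l" if "0 \<le> y - a * real_of_int k" "y - a * real_of_int k < a"
    "0 \<le> y - a * real_of_int l" "y - a * real_of_int l < a" "a > 0" for y a :: real and k l :: int
  proof -
    have "a * real_of_int k < a * (real_of_int l + 1)" "a * real_of_int l < a * (real_of_int k + 1)"
      using that by (simp_all add: algebra_simps)
    then show ?thesis
      using \<open>a > 0\<close> by simp
  qed
  have snd: "snd p = snd q"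
    using assms row_height_pos by (intro unit[of "z $ 2" row_height])
      (auto simp: cell_def lattice_point_def vector_2)
  moreover have "fst p = fst q"
    using assms spacing_pos snd by (intro unit[of "z $ 1 - spacing / 2 * snd q" spacing])
      (auto simp: cell_def lattice_point_def vector_2 algebra_simps)
  ultimately show ?thesis
    by (simp add: prod_eq_iff)
qed

lemma cell_subset_cbox: "cell \<subseteq> cbox 0 (vector [spacing, row_height])"
  by (auto simp: cell_def mem_box_cart forall_2 vector_2)

lemma cell_measurable: "cell \<in> lmeasurable"
proof (rule bounded_set_imp_lmeasurable)
  show "bounded cell"
    using cell_subset_cbox bounded_cbox bounded_subset by blast
  have "cell = ({t. 0 \<le> t $ 1} \<inter> {t. 0 \<le> t $ 2}) \<inter> ({t. t $ 1 < spacing} \<inter> {t. t $ 2 < row_height})"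
    by (auto simp: cell_def)
  moreover have "closed ({t::real^2. 0 \<le> t $ 1} \<inter> {t. 0 \<le> t $ 2})"
    by (intro closed_Int closed_Collect_le continuous_intros)
  moreover have "open ({t::real^2. t $ 1 < spacing} \<inter> {t. t $ 2 < row_height})"
    by (intro open_Int open_Collect_less continuous_intros)
  ultimately have "cell \<in> sets borel"
    by (metis borel_closed borel_open sets.Int)
  then show "cell \<in> sets lebesgue"
    by (simp add: sets_completionI_sets)
qed

lemma measure_cell: "measure lebesgue cell = spacing * row_height"
proof -
  define v :: "real^2" where "v = vector [spacing, row_height]"
  have basis: "(Basis :: (real^2) set) = {axis 1 1, axis 2 1}"
    by (auto simp: Basis_vec_def UNIV_2)
  have neq: "axis 1 1 \<noteq> (axis 2 1 :: real^2)"
    by (simp add: axis_eq_axis)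
  have content: "measure lborel (cbox 0 v) = spacing * row_height" "measure lborel (box 0 v) = spacing * row_height"
    using spacing_pos row_height_pos neq
    by (simp_all add: measure_lborel_cbox_eq measure_lborel_box_eq basis v_def inner_axis vector_2)
  have sub: "box 0 v \<subseteq> cell" "cell \<subseteq> cbox 0 v"
    using cell_subset_cbox by (auto simp: cell_def mem_box_cart forall_2 vector_2 v_def)
  have "measure lebesgue (box 0 v) \<le> measure lebesgue cell"
    using sub cell_measurable by (intro measure_mono_fmeasurable) auto
  moreover have "measure lebesgue cell \<le> measure lebesgue (cbox 0 v)"
    using sub cell_measurable by (intro measure_mono_fmeasurable) auto
  ultimately show ?thesis
    using content by simp
qed

section \<open>Averaging over translations\<close>

text \<open>All counts below are over a finite set of lattice points. For the averages to be exact, it must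
  contain every lattice point whose disk can reach X under a translation from the cell.\<close>
lemma finitely_many_lattice_points_near:
  assumes "finite X"
  obtains I where "finite I" "\<And>x t p. x \<in> X \<Longrightarrow> t \<in> cell \<Longrightarrow> norm (x + t - lattice_point p) < 1 \<Longrightarrow> p \<in> I"
proof -
  have "bounded X" "bounded cell"
    using assms finite_imp_bounded bounded_subset[OF bounded_cbox cell_subset_cbox] by auto
  then obtain B C where B: "\<And>x. x \<in> X \<Longrightarrow> norm x \<le> B" and C: "\<And>t. t \<in> cell \<Longrightarrow> norm t \<le> C"
    by (meson bounded_iff)
  define R where "R = B + C + 1"
  define I where "I = {- \<lceil>R\<rceil>..\<lceil>R\<rceil>} \<times> {- \<lceil>R\<rceil>..\<lceil>R\<rceil>}"
  have "p \<in> I" if "x \<in> X" "t \<in> cell" "norm (x + t - lattice_point p) < 1" for x t p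
  proof -
    have "lattice_point p = (x + t) - (x + t - lattice_point p)"
      by simp
    then have "norm (lattice_point p) \<le> norm (x + t) + norm (x + t - lattice_point p)"
      by (metis norm_triangle_ineq4)
    then have "norm (lattice_point p) \<le> R"
      using norm_triangle_ineq[of x t] B[OF that(1)] C[OF that(2)] that(3) by (simp add: R_def)
    moreover have "R \<ge> 0"
      using calculation norm_ge_zero order_trans by blast
    ultimately have "lattice_point p \<bullet> lattice_point p \<le> R\<^sup>2"
      by (simp add: norm_le_square)
    define i j where "i = fst p" and "j = snd p"
    define m where "m = i\<^sup>2 + i * j + j\<^sup>2"
    have "2 * m = i\<^sup>2 + j\<^sup>2 + (i + j)\<^sup>2"
      by (simp add: m_def power2_eq_square algebra_simps)
    then have m: "i\<^sup>2 \<le> 2 * m" "j\<^sup>2 \<le> 2 * m" "0 \<le> m"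
      using zero_le_power2[of "i + j"] zero_le_power2[of i] zero_le_power2[of j] by linarith+
    have "spacing\<^sup>2 * of_int m \<le> R\<^sup>2"
      using \<open>lattice_point p \<bullet> lattice_point p \<le> R\<^sup>2\<close> by (simp add: lattice_point_inner m_def i_def j_def)
    moreover have "2 * real_of_int m \<le> spacing\<^sup>2 * of_int m"
      using m(3) by (intro mult_right_mono) (simp_all add: spacing_def power2_eq_square)
    ultimately have "real_of_int (2 * m) \<le> R\<^sup>2"
      by simp
    then have "(real_of_int i)\<^sup>2 \<le> R\<^sup>2" "(real_of_int j)\<^sup>2 \<le> R\<^sup>2"
      using m(1,2) by (metis of_int_le_iff of_int_power order_trans)+
    then have "\<bar>real_of_int i\<bar> \<le> R" "\<bar>real_of_int j\<bar> \<le> R"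
      using \<open>R \<ge> 0\<close> by (simp_all add: abs_le_square_iff[symmetric])
    then have "i \<in> {- \<lceil>R\<rceil>..\<lceil>R\<rceil>}" "j \<in> {- \<lceil>R\<rceil>..\<lceil>R\<rceil>}"
      by (auto simp: abs_le_iff) linarith+
    then show ?thesis
      by (simp add: I_def i_def j_def mem_Times_iff)
  qed
  moreover have "finite I"
    by (simp add: I_def)
  ultimately show ?thesis
    using that by blast
qed

definition hits :: "(int \<times> int) set \<Rightarrow> (real^2) set \<Rightarrow> real^2 \<Rightarrow> real^2 \<Rightarrow> nat" where
  "hits I T x t = card {p \<in> I. x + t - lattice_point p \<in> T}"

text \<open>The translates of T by lattice points, restricted to the cell, can be
  moved back to a partition of T.\<close>
lemma integral_hits:
  assumes I: "finite I" "\<And>t p. t \<in> cell \<Longrightarrow> norm (x + t - lattice_point p) < 1 \<Longrightarrow> p \<in> I"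
    and T: "T \<in> lmeasurable" "T \<subseteq> ball 0 1"
  shows "has_bochner_integral lebesgue (\<lambda>t. indicator cell t * real (hits I T x t)) (measure lebesgue T)"
proof -
  define B where "B p = T \<inter> (+) (x - lattice_point p) ` cell" for p
  define A where "A p = (+) (lattice_point p - x) ` B p" for p
  have B: "B p \<in> lmeasurable" for p
    unfolding B_def using T cell_measurable by (intro fmeasurable.Int measurable_translation)
  have A: "A p \<in> lmeasurable" "measure lebesgue (A p) = measure lebesgue (B p)" for p
    unfolding A_def using B by (simp_all add: measurable_translation measure_translation)
  have B_iff: "y \<in> B p \<longleftrightarrow> y \<in> T \<and> y - x - lattice_point (- p) \<in> cell" for y p
  proof -
    have "y \<in> (+) (x - lattice_point p) ` cell \<longleftrightarrow> y - (x - lattice_point p) \<in> cell"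
      by (force simp: image_iff)
    then show ?thesis
      by (simp add: B_def lattice_point_minus algebra_simps)
  qed
  have A_iff: "t \<in> A p \<longleftrightarrow> t \<in> cell \<and> x + t - lattice_point p \<in> T" for t p
    by (force simp: A_def B_def image_iff algebra_simps)
  have T_eq: "T = (\<Union>p\<in>I. B p)"
  proof (intro equalityI subsetI)
    fix y assume y: "y \<in> T"
    obtain p where p: "y - x - lattice_point p \<in> cell"
      using cell_translates_cover by blast
    then have "y \<in> B (- p)"
      using y by (simp add: B_iff)
    moreover have "norm y < 1"
      using y T(2) by auto
    then have "- p \<in> I"
      using I(2)[OF p, of "- p"] by (simp add: lattice_point_minus)
    ultimately show "y \<in> (\<Union>p\<in>I. B p)"
      by blast
  qed (auto simp: B_def)
  have disjoint: "disjoint_family_on B I"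
    unfolding disjoint_family_on_def
    using cell_translates_disjoint by (fastforce simp: B_iff)
  have "measure lebesgue (\<Union>p\<in>I. B p) = (\<Sum>p\<in>I. measure lebesgue (B p))"
  proof (rule measure_finite_Union[OF I(1) _ disjoint])
    show "B ` I \<subseteq> sets lebesgue"
      using B fmeasurableD by auto
    show "emeasure lebesgue (B p) \<noteq> \<infinity>" for p
      using fmeasurableD2[OF B] unfolding infinity_ennreal_def .
  qed
  then have "measure lebesgue T = (\<Sum>p\<in>I. measure lebesgue (A p))"
    by (simp only: A(2) T_eq[symmetric])
  moreover have single: "has_bochner_integral lebesgue (indicator (A p) :: _ \<Rightarrow> real) (measure lebesgue (A p))" for p
  proof (rule has_bochner_integral_real_indicator)
    show "A p \<in> sets lebesgue"
      using A(1) by (rule fmeasurableD)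
    show "emeasure lebesgue (A p) < \<infinity>"
      using A(1)[of p] unfolding fmeasurable_def by blast
  qed
  have "has_bochner_integral lebesgue (\<lambda>t. \<Sum>p\<in>I. indicator (A p) t :: real) (\<Sum>p\<in>I. measure lebesgue (A p))"
    by (rule has_bochner_integral_sum) (rule single)
  moreover have "(\<Sum>p\<in>I. indicator (A p) t :: real) = indicator cell t * real (hits I T x t)" for t
  proof -
    have "(\<Sum>p\<in>I. indicator (A p) t) = (\<Sum>p\<in>I. if t \<in> cell \<and> x + t - lattice_point p \<in> T then 1 else (0::real))"
      by (intro sum.cong refl) (simp add: indicator_def A_iff)
    also have "\<dots> = real (card {p \<in> I. t \<in> cell \<and> x + t - lattice_point p \<in> T})"
      using I(1) by (simp add: sum.inter_filter[symmetric])
    finally show ?thesis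
      by (auto simp: hits_def indicator_def)
  qed
  ultimately show ?thesis
    by simp
qed

definition disk_hits :: "(int \<times> int) set \<Rightarrow> real^2 \<Rightarrow> real^2 \<Rightarrow> nat" where
  "disk_hits I = hits I (ball 0 1)"

definition cap_hits :: "(int \<times> int) set \<Rightarrow> int \<times> int \<Rightarrow> real^2 \<Rightarrow> real^2 \<Rightarrow> nat" where
  "cap_hits I e = hits I (cap (lattice_point e))"

text \<open>The left-hand side bounds the number of bad points from above. A non-special point that is
  covered N times and lies in W half lenses contributes 1 - N + 2 W, so 1 for N = 0, 0 for N = 1, and
  at least 1 for N = 2, where W is at least 1. The last sum is the
  saving for the extremal points m e. In the integral over the cell, N contributes pi, and the half
  lenses together contribute at most six times the bound of \<open>cap_area\<close>.\<close>
lemma good_translation: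
  fixes Q S :: "(real^2) set"
  assumes QS: "finite Q" "card Q = 13" "finite S" "card S = 4" and m: "m ` neighbours \<subseteq> Q"
    and I: "finite I" "\<And>x t p. x \<in> Q \<union> S \<Longrightarrow> t \<in> cell \<Longrightarrow> norm (x + t - lattice_point p) < 1 \<Longrightarrow> p \<in> I"
  obtains t where "(\<Sum>q\<in>Q. 1 - real (disk_hits I q t) + 2 * (\<Sum>e\<in>neighbours. real (cap_hits I e q t)))
     + (\<Sum>s\<in>S. \<Sum>e\<in>neighbours. real (cap_hits I e s t))
     - (\<Sum>e\<in>neighbours. real (cap_hits I e (m e) t)) < 1"
proof (rule ccontr)
  note * = that
  assume no: "\<not> thesis"
  define c where "c = (indicator cell :: real^2 \<Rightarrow> real)"
  define N where "N x t = real (disk_hits I x t)" for x t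
  define H where "H e x t = real (cap_hits I e x t)" for e x t
  define \<kappa> where "\<kappa> e = measure lebesgue (cap (lattice_point e))" for e
  define cost where "cost t = (\<Sum>q\<in>Q. 1 - N q t + 2 * (\<Sum>e\<in>neighbours. H e q t))
     + (\<Sum>s\<in>S. \<Sum>e\<in>neighbours. H e s t) - (\<Sum>e\<in>neighbours. H e (m e) t)" for t
  have cost_ge: "cost t \<ge> 1" if "t \<in> cell" for t
    using no *[of t] unfolding cost_def N_def H_def by force
  have ball: "measure lebesgue (ball (0::real^2) 1) = pi"
    using content_ball[of 1 "0 :: real^2"] by (simp add: unit_ball_vol_2)
  have N: "has_bochner_integral lebesgue (\<lambda>t. c t * N x t) pi" if "x \<in> Q \<union> S" for x
    unfolding c_def N_def disk_hits_def ball[symmetric] using I that by (intro integral_hits) auto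
  have H: "has_bochner_integral lebesgue (\<lambda>t. c t * H e x t) (\<kappa> e)" if "x \<in> Q \<union> S" for e x
    unfolding c_def H_def cap_hits_def \<kappa>_def using I that
    by (intro integral_hits cap_measurable) (auto simp: cap_def)
  have c: "has_bochner_integral lebesgue c (spacing * row_height)"
    unfolding c_def measure_cell[symmetric] using cell_measurable
    by (intro has_bochner_integral_real_indicator) (auto simp: fmeasurable_def)
  define K where "K = (\<Sum>e\<in>neighbours. \<kappa> e)"
  have "has_bochner_integral lebesgue
    (\<lambda>t. (\<Sum>q\<in>Q. c t - c t * N q t + 2 * (\<Sum>e\<in>neighbours. c t * H e q t))
     + (\<Sum>s\<in>S. \<Sum>e\<in>neighbours. c t * H e s t) - (\<Sum>e\<in>neighbours. c t * H e (m e) t))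
    ((\<Sum>q\<in>Q. spacing * row_height - pi + 2 * K) + (\<Sum>s\<in>S. K) - K)"
    unfolding K_def using m
    by (intro has_bochner_integral_diff has_bochner_integral_add has_bochner_integral_sum
        has_bochner_integral_mult_right c N H) auto
  moreover have "(\<Sum>q\<in>Q. c t - c t * N q t + 2 * (\<Sum>e\<in>neighbours. c t * H e q t))
     + (\<Sum>s\<in>S. \<Sum>e\<in>neighbours. c t * H e s t) - (\<Sum>e\<in>neighbours. c t * H e (m e) t) = c t * cost t" for t
    by (cases "t \<in> cell") (simp_all add: c_def cost_def)
  ultimately have int: "has_bochner_integral lebesgue (\<lambda>t. c t * cost t)
      (13 * (spacing * row_height - pi + 2 * K) + 4 * K - K)"
    using QS by simp
  have "integral\<^sup>L lebesgue c \<le> integral\<^sup>L lebesgue (\<lambda>t. c t * cost t)"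
  proof (rule integral_mono)
    show "c t \<le> c t * cost t" for t
      using cost_ge[of t] by (simp add: c_def indicator_def)
  qed (use c int in \<open>simp_all add: has_bochner_integral_iff\<close>)
  then have "spacing * row_height \<le> 13 * (spacing * row_height - pi + 2 * K) + 4 * K - K"
    using c int by (simp add: has_bochner_integral_iff)
  moreover have "K \<le> 6 * (144/15625)"
  proof -
    have "K \<le> (\<Sum>e\<in>neighbours. 144/15625)"
      unfolding K_def \<kappa>_def by (intro sum_mono cap_area norm_lattice_neighbour)
    then show ?thesis
      by (simp add: neighbours_def)
  qed
  moreover have "sqrt 3 < 173206/100000"
    by (rule real_less_lsqrt) (simp_all add: power2_eq_square)
  then have "spacing * row_height < 326747/100000"
    by (simp add: spacing_def row_height_def)
  moreover have "pi \<ge> 314159/100000"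
    using pi_approx(1) by simp
  \<comment> \<open>The margin is small: \<open>13 p\<close> is about 40.841, and \<open>12 a + 29 k\<close> is at most about 40.813.\<close>
  moreover have "\<not> a \<le> 13 * (a - p + 2 * k) + 4 * k - k"
    if "k \<le> 6 * (144/15625)" "a < 326747/100000" "314159/100000 \<le> p" for a p k :: real
    using that by simp
  ultimately show False
    by blast
qed

section \<open>Covering by lattice disks\<close>
lemma two_disks_meet_in_cap:
  assumes pq: "p \<noteq> q" and u: "norm (z - lattice_point p) < 1" and v: "norm (z - lattice_point q) < 1"
  shows "q - p \<in> neighbours"
    and "z - lattice_point p \<in> cap (lattice_point (q - p)) \<or> z - lattice_point q \<in> cap (lattice_point (p - q))"
proof -
  have "norm (lattice_point q - lattice_point p) < 2"
    using norm_triangle_ineq4[of "z - lattice_point p" "z - lattice_point q"] u v by simp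
  then show "q - p \<in> neighbours"
    using close_lattice_points_neighbours pq by metis
  define e where "e = lattice_point (q - p)"
  have e: "lattice_point (p - q) = - e" "z - lattice_point q = (z - lattice_point p) - e"
    by (simp_all add: e_def lattice_point_diff)
  show "z - lattice_point p \<in> cap (lattice_point (q - p)) \<or> z - lattice_point q \<in> cap (lattice_point (p - q))"
  proof (cases "e \<bullet> e / 2 \<le> e \<bullet> (z - lattice_point p)")
    case True
    then show ?thesis
      using u by (simp add: cap_def e_def)
  next
    case False
    then have "e \<bullet> e / 2 \<le> - e \<bullet> (z - lattice_point p - e)"
      by (simp add: inner_diff_right)
    then show ?thesis
      using v unfolding e by (simp add: cap_def)
  qed
qed

text \<open>Fix one of the disks that contain x. Each of the others meets it in a lens around x, and
  different disks yield different half lenses.\<close>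
lemma disk_hits_le_cap_hits:
  assumes I: "finite I"
  shows "disk_hits I x t \<le> 1 + (\<Sum>e\<in>neighbours. cap_hits I e x t)"
proof -
  define M where "M = {p \<in> I. norm (x + t - lattice_point p) < 1}"
  define Z where "Z = (SIGMA e:neighbours. {p \<in> I. x + t - lattice_point p \<in> cap (lattice_point e)})"
  have finite: "finite M" "finite neighbours"
    using I by (simp_all add: M_def neighbours_def)
  have hits: "disk_hits I x t = card M"
    by (simp add: disk_hits_def hits_def M_def)
  have Z: "card Z = (\<Sum>e\<in>neighbours. cap_hits I e x t)" "finite Z"
    using I finite(2) by (simp_all add: Z_def cap_hits_def hits_def)
  show ?thesis
  proof (cases "M = {}")
    case False
    then obtain p where p: "p \<in> M"
      by blast
    \<comment> \<open>Either half of the lens of p and q may contain x; in both cases f q determines q.\<close>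
    define f where "f q = (if x + t - lattice_point p \<in> cap (lattice_point (q - p)) then (q - p, p) else (p - q, q))" for q
    have "f q \<in> Z" if "q \<in> M - {p}" for q
      using two_disks_meet_in_cap[of p q "x + t"] two_disks_meet_in_cap(1)[of q p "x + t"] p that
      by (auto simp: f_def Z_def M_def)
    then have "f ` (M - {p}) \<subseteq> Z"
      by blast
    moreover have "inj_on f (M - {p})"
      by (auto simp: inj_on_def f_def split: if_splits)
    ultimately have "card (M - {p}) \<le> card Z"
      using Z(2) by (metis card_image card_mono)
    then show ?thesis
      using hits Z(1) p finite(1) by (simp add: card_Diff_singleton)
  qed (simp add: hits)
qed

text \<open>The line through y orthogonal to e cuts off a part of the disk around 0 that lies
  in the disk around e, since it is beyond the perpendicular bisector of the two centres.\<close>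
lemma disk_in_disk_beyond_cap:
  assumes y: "y \<in> cap e" and z: "norm z < 1" and le: "e \<bullet> y \<le> e \<bullet> z"
  shows "norm (z - e) < 1"
proof -
  have "(z - e) \<bullet> (z - e) = z \<bullet> z - 2 * (e \<bullet> z) + e \<bullet> e"
    by (simp add: inner_diff_left inner_diff_right inner_commute)
  also have "\<dots> \<le> z \<bullet> z"
    using y le by (simp add: cap_def)
  finally have "norm (z - e) \<le> norm z"
    by (simp add: norm_le)
  then show ?thesis
    using z by simp
qed

text \<open>By \<open>disk_hits_le_cap_hits\<close> each point contributes a nonnegative integer to the total of
  \<open>good_translation\<close>, even if all its half lenses are subject to the saving. As the total is
  less than 1, all contributions vanish. A half lens around q with \<open>m e \<noteq> q\<close> would not be subject to the
  saving, and would make the contribution of q positive.\<close>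
lemma translation_without_defects:
  fixes Q S :: "(real^2) set"
  assumes QS: "finite Q" "card Q = 13" "finite S" "card S = 4" and m: "m ` neighbours \<subseteq> Q"
  obtains I t where "finite I"
    "\<And>q. q \<in> Q \<Longrightarrow> \<exists>p\<in>I. norm (q + t - lattice_point p) < 1"
    "\<And>q p e. q \<in> Q \<Longrightarrow> p \<in> I \<Longrightarrow> e \<in> neighbours \<Longrightarrow> q + t - lattice_point p \<in> cap (lattice_point e) \<Longrightarrow> m e = q"
    "\<And>s p p'. s \<in> S \<Longrightarrow> p \<in> I \<Longrightarrow> p' \<in> I \<Longrightarrow> norm (s + t - lattice_point p) < 1
      \<Longrightarrow> norm (s + t - lattice_point p') < 1 \<Longrightarrow> p = p'"
proof -
  have "finite (Q \<union> S)"
    using QS by simp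
  then obtain I where I: "finite I"
    "\<And>x t p. x \<in> Q \<union> S \<Longrightarrow> t \<in> cell \<Longrightarrow> norm (x + t - lattice_point p) < 1 \<Longrightarrow> p \<in> I"
    using finitely_many_lattice_points_near by metis
  obtain t where t: "(\<Sum>q\<in>Q. 1 - real (disk_hits I q t) + 2 * (\<Sum>e\<in>neighbours. real (cap_hits I e q t)))
     + (\<Sum>s\<in>S. \<Sum>e\<in>neighbours. real (cap_hits I e s t))
     - (\<Sum>e\<in>neighbours. real (cap_hits I e (m e) t)) < 1"
    by (rule good_translation[OF QS m I])
  define W where "W x = (\<Sum>e\<in>neighbours. int (cap_hits I e x t))" for x
  define saved where "saved q = (\<Sum>e | e \<in> neighbours \<and> m e = q. int (cap_hits I e q t))" for q
  define cost where "cost q = 1 - int (disk_hits I q t) + 2 * W q - saved q" for q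
  have fin: "finite neighbours"
    by (simp add: neighbours_def)
  have "(\<Sum>e\<in>neighbours. int (cap_hits I e (m e) t))
      = (\<Sum>q\<in>Q. \<Sum>e | e \<in> neighbours \<and> m e = q. int (cap_hits I e (m e) t))"
    using sum.group[OF fin QS(1) m, of "\<lambda>e. int (cap_hits I e (m e) t)"] by simp
  also have "\<dots> = (\<Sum>q\<in>Q. saved q)"
    unfolding saved_def by (intro sum.cong) auto
  finally have saved_sum: "(\<Sum>e\<in>neighbours. int (cap_hits I e (m e) t)) = (\<Sum>q\<in>Q. saved q)" .
  have "real_of_int ((\<Sum>q\<in>Q. 1 - int (disk_hits I q t) + 2 * W q) + (\<Sum>s\<in>S. W s)
      - (\<Sum>e\<in>neighbours. int (cap_hits I e (m e) t))) < 1"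
    using t by (simp add: W_def)
  then have "(\<Sum>q\<in>Q. 1 - int (disk_hits I q t) + 2 * W q) + (\<Sum>s\<in>S. W s)
      - (\<Sum>e\<in>neighbours. int (cap_hits I e (m e) t)) < 1"
    by (simp only: of_int_less_1_iff)
  then have total: "(\<Sum>q\<in>Q. cost q) + (\<Sum>s\<in>S. W s) \<le> 0"
    by (simp add: saved_sum cost_def sum_subtractf)
  have W0: "W x \<ge> 0" for x
    by (simp add: W_def sum_nonneg)
  have hits_le: "int (disk_hits I x t) \<le> 1 + W x" for x
    using disk_hits_le_cap_hits[OF I(1), of x t] unfolding W_def by (simp flip: of_nat_sum)
  have saved_le: "saved q \<le> W q" for q
    unfolding saved_def W_def using fin by (intro sum_mono2) auto
  have cost0: "cost q \<ge> 0" for q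
    using hits_le[of q] saved_le[of q] by (simp add: cost_def)
  have "(\<Sum>q\<in>Q. cost q) \<ge> 0" "(\<Sum>s\<in>S. W s) \<ge> 0"
    using cost0 W0 by (simp_all add: sum_nonneg)
  then have "(\<Sum>q\<in>Q. cost q) = 0" "(\<Sum>s\<in>S. W s) = 0"
    using total by linarith+
  then have cost: "\<And>q. q \<in> Q \<Longrightarrow> cost q = 0" and W: "\<And>s. s \<in> S \<Longrightarrow> W s = 0"
    using QS cost0 W0 by (simp_all add: sum_nonneg_eq_0_iff)
  show ?thesis
  proof (rule that[OF I(1), of t])
    fix q assume q: "q \<in> Q"
    have "disk_hits I q t \<noteq> 0"
      using cost[OF q] saved_le[of q] W0[of q] by (auto simp: cost_def)
    then have "card {p \<in> I. norm (q + t - lattice_point p) < 1} \<noteq> 0"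
      by (simp add: disk_hits_def hits_def)
    then have "{p \<in> I. norm (q + t - lattice_point p) < 1} \<noteq> {}"
      by (metis card.empty)
    then show "\<exists>p\<in>I. norm (q + t - lattice_point p) < 1"
      by blast
  next
    fix q p e assume q: "q \<in> Q" and p: "p \<in> I" and e: "e \<in> neighbours"
      and "q + t - lattice_point p \<in> cap (lattice_point e)"
    then have "{r \<in> I. q + t - lattice_point r \<in> cap (lattice_point e)} \<noteq> {}"
      by blast
    then have "cap_hits I e q t > 0"
      unfolding cap_hits_def hits_def using I(1) by (simp only: card_gt_0_iff) simp
    show "m e = q"
    proof (rule ccontr)
      assume "m e \<noteq> q"
      then have "saved q \<le> (\<Sum>e\<in>neighbours - {e}. int (cap_hits I e q t))"
        unfolding saved_def using fin by (intro sum_mono2) auto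
      also have "\<dots> = W q - int (cap_hits I e q t)"
        unfolding W_def using fin e by (simp add: sum_diff1)
      finally show False
        using \<open>cap_hits I e q t > 0\<close> cost[OF q] hits_le[of q] by (simp add: cost_def)
    qed
  next
    fix s p p' assume s: "s \<in> S" and pp: "p \<in> I" "p' \<in> I" "norm (s + t - lattice_point p) < 1"
      "norm (s + t - lattice_point p') < 1"
    have "card {p \<in> I. norm (s + t - lattice_point p) < 1} \<le> Suc 0"
      using hits_le[of s] W[OF s] by (simp add: disk_hits_def hits_def)
    then have "\<forall>a\<in>{p \<in> I. norm (s + t - lattice_point p) < 1}. \<forall>b\<in>{p \<in> I. norm (s + t - lattice_point p) < 1}. a = b"
      using I(1) by (subst (asm) card_le_Suc0_iff_eq) simp_all
    then show "p = p'"
      using pp by blast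
  qed
qed

text \<open>Among the sets of lattice disks that cover all non-special points take a smallest one. Were
  a non-special point contained in two of its disks, it would be extremal in the direction of one of the
  two half lenses, and the disk at the back could be dropped.\<close>
lemma exact_cover_by_lattice_disks:
  assumes X: "finite X" "card X = 17" and S: "S \<subseteq> X" "card S = 4"
    and priv: "\<And>s. s \<in> S \<Longrightarrow> private_point X s"
  shows "\<exists>\<D>. exact_cover \<D> X"
proof -
  define Q where "Q = X - S"
  have finS: "finite S"
    using X S finite_subset by blast
  have Q: "finite Q" "card Q = 13"
    using X S finS by (simp_all add: Q_def card_Diff_subset)
  have "\<exists>q\<in>Q. \<forall>z\<in>Q. lattice_point e \<bullet> q \<le> lattice_point e \<bullet> z" for e
  proof -
    have "Q \<noteq> {}"
      using Q by auto
    then have "Min ((\<bullet>) (lattice_point e) ` Q) \<in> (\<bullet>) (lattice_point e) ` Q"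
      using Q by (intro Min_in) auto
    then obtain q where "q \<in> Q" "lattice_point e \<bullet> q = Min ((\<bullet>) (lattice_point e) ` Q)"
      by auto
    then show ?thesis
      using Q(1) by (metis Min_le finite_imageI imageI)
  qed
  then obtain m where m: "\<And>e. m e \<in> Q" "\<And>e z. z \<in> Q \<Longrightarrow> lattice_point e \<bullet> m e \<le> lattice_point e \<bullet> z"
    by metis
  then have "m ` neighbours \<subseteq> Q"
    by blast
  from translation_without_defects[OF Q finS S(2) this]
  obtain I t where I: "finite I"
    and covered: "\<And>q. q \<in> Q \<Longrightarrow> \<exists>p\<in>I. norm (q + t - lattice_point p) < 1"
    and extremal: "\<And>q p e. q \<in> Q \<Longrightarrow> p \<in> I \<Longrightarrow> e \<in> neighbours
      \<Longrightarrow> q + t - lattice_point p \<in> cap (lattice_point e) \<Longrightarrow> m e = q"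
    and S_once: "\<And>s p p'. s \<in> S \<Longrightarrow> p \<in> I \<Longrightarrow> p' \<in> I \<Longrightarrow> norm (s + t - lattice_point p) < 1
      \<Longrightarrow> norm (s + t - lattice_point p') < 1 \<Longrightarrow> p = p'"
    by blast
  define covers where "covers F \<longleftrightarrow> F \<subseteq> I \<and> (\<forall>q\<in>Q. \<exists>p\<in>F. norm (q + t - lattice_point p) < 1)" for F
  have "covers I"
    using covered by (simp add: covers_def)
  then obtain F where F: "covers F" "\<And>G. covers G \<Longrightarrow> card F \<le> card G"
    using ex_has_least_nat[of covers I card] by blast
  have FI: "F \<subseteq> I" "finite F"
    using F(1) I finite_subset by (auto simp: covers_def)
  have no_cap: "z - lattice_point p \<notin> cap (lattice_point (p' - p))"
    if z: "z = q + t" "q \<in> Q" and pp: "p \<in> F" "p' \<in> F" "p \<noteq> p'" "p' - p \<in> neighbours" for z q p p'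
  proof
    assume "z - lattice_point p \<in> cap (lattice_point (p' - p))"
    then have cap: "q + t - lattice_point p \<in> cap (lattice_point (p' - p))"
      using z by simp
    then have mq: "m (p' - p) = q"
      using extremal z(2) pp FI by blast
    \<comment> \<open>As q is least in direction \<open>p' - p\<close>, all other points in the disk of p are in that of p' too.\<close>
    have "covers (F - {p})"
      unfolding covers_def
    proof (intro conjI ballI)
      show "F - {p} \<subseteq> I"
        using FI by blast
      fix y assume y: "y \<in> Q"
      then obtain r where r: "r \<in> F" "norm (y + t - lattice_point r) < 1"
        using F(1) by (auto simp: covers_def)
      show "\<exists>r\<in>F - {p}. norm (y + t - lattice_point r) < 1"
      proof (cases "r = p")
        case True
        have "lattice_point (p' - p) \<bullet> (q + t - lattice_point p) \<le> lattice_point (p' - p) \<bullet> (y + t - lattice_point p)"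
          using m(2)[OF y, of "p' - p"] mq by (simp add: inner_add_right inner_diff_right)
        then have "norm (y + t - lattice_point p - lattice_point (p' - p)) < 1"
          using disk_in_disk_beyond_cap[OF cap] r(2) True by blast
        then have "norm (y + t - lattice_point p') < 1"
          by (simp add: lattice_point_diff algebra_simps)
        then show ?thesis
          using pp by blast
      next
        case False
        then show ?thesis
          using r by blast
      qed
    qed
    then show False
      using F(2) pp(1) FI(2) by (metis card_Diff1_less not_less)
  qed
  have Q_once: "p = p'" if "q \<in> Q" "p \<in> F" "p' \<in> F" "norm (q + t - lattice_point p) < 1"
    "norm (q + t - lattice_point p') < 1" for q p p'
    using two_disks_meet_in_cap[of p p' "q + t"] two_disks_meet_in_cap(1)[of p' p "q + t"]
      no_cap[OF refl that(1-3)] no_cap[OF refl that(1,3,2)] that by blast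
  define \<C> where "\<C> = (\<lambda>p. unit_disk (lattice_point p - t)) ` F"
  have in_disk: "x \<in> unit_disk (lattice_point p - t) \<longleftrightarrow> norm (x + t - lattice_point p) < 1" for x p
    by (simp add: unit_disk_def algebra_simps)
  show ?thesis
  proof (rule exact_cover_by_private_points)
    show "\<C> \<subseteq> range unit_disk"
      by (auto simp: \<C>_def)
    show "D = D'" if D: "x \<in> X" "D \<in> \<C>" "D' \<in> \<C>" "x \<in> D" "x \<in> D'" for x D D'
    proof -
      obtain p p' where p: "p \<in> F" "p' \<in> F" "D = unit_disk (lattice_point p - t)"
        "D' = unit_disk (lattice_point p' - t)"
        using D(2,3) unfolding \<C>_def by blast
      have "p = p'"
      proof (cases "x \<in> S")
        case True
        then show ?thesis
          using S_once[of x p p'] p FI(1) D(4,5) by (auto simp: in_disk)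
      next
        case False
        then show ?thesis
          using Q_once[of x p p'] p D by (auto simp: Q_def in_disk)
      qed
      then show ?thesis
        using p by simp
    qed
    fix x assume x: "x \<in> X - \<Union>\<C>"
    have "x \<notin> Q"
      using F(1) x by (auto simp: covers_def \<C>_def in_disk)
    then show "private_point X x"
      using x priv by (simp add: Q_def)
  qed
qed

theorem theorem1p2: "sigma_hat_2 \<ge> 17"
proof -
  have "all_exactly_coverable 17"
    unfolding all_exactly_coverable_def
  proof (intro allI impI)
    fix X :: "(real^2) set" assume X: "finite X \<and> card X = 17"
    show "\<exists>\<D>. exact_cover \<D> X"
    proof (cases "\<exists>z. X \<subseteq> cball z 1")
      case True
      then show ?thesis
        using exact_cover_if_in_cball X by blast
    next
      case False
      then have "4 \<le> card {x \<in> X. private_point X x}"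
        using X by (intro four_private_points) auto
      then obtain S where "S \<subseteq> {x \<in> X. private_point X x}" "card S = 4" "finite S"
        by (rule obtain_subset_with_card_n)
      then show ?thesis
        using X by (intro exact_cover_by_lattice_disks) auto
    qed
  qed
  moreover obtain b where "\<forall>n. all_exactly_coverable n \<longrightarrow> n \<le> b"
    using exactly_coverable_bounded by blast
  ultimately show ?thesis
    unfolding sigma_hat_2_def by (intro Greatest_le_nat[of _ 17 b]) simp_all
qed

end
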